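(* Let $E$ be a locally complete lcHs over $\mathbb{K}$, let the linear subspace $G\subset E'$ determine boundedness and let $F(\Omega)$ and $F(\Omega,E)$ be $\varepsilon$-into-compatible. Let $(T^{E},T^{\mathbb{K}})$ be a generator for $(\mathcal{F}\nu,E)$ and a strong, consistent family for $(F,E)$, let $\mathcal{F}\nu(\Omega)$ be a Banach space whose closed unit ball $B_{\mathcal{F}\nu(\Omega)}$ is a compact subset of $F(\Omega)$, and let $U$ be a set of uniqueness for $(T^{\mathbb{K}},\mathcal{F}\nu)$. Then the restriction map \[ R_{U,G}\colon\mathcal{F}_{\varepsilon}\nu(\Omega,E)\to\mathcal{F}\nu_{G}(U,E),\; f\mapsto(T^{E}(f)(x))_{x\in U}, \] is surjective.
   Context: $\mathbb{K}=\mathbb{R}$ or $\mathbb{C}$. An lcHs is a non-trivial locally convex Hausdorff space over $\mathbb{K}$; the topology of $E$ is given by a directed system of seminorms $(p_\alpha)_{\alpha\in\mathfrak{A}}$ (for $E=\mathbb{K}$: $\{|\cdot|\}$). For an lcHs $X$, $X'_{\kappa}$ is $X'$ with the topology of uniform convergence on absolutely convex compact subsets of $X$, and $X\varepsilon E:=L_{e}(X'_{\kappa},E)$ carries the topology of uniform convergence on equicontinuous subsets of $X'$. $\delta_x(f):=f(x)$. $E$ is locally complete if for every closed bounded absolutely convex $D\subset E$ the space $E_D:=\bigcup_n nD$, normed by the gauge of $D$, is a Banach space. $G\subset E'$ determines boundedness if every $\sigma(E,G)$-bounded subset of $E$ is bounded. Setting: $\Omega,\omega$ are non-empty sets, $\nu\colon\omega\to(0,\infty)$.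 For $Y\in\{\mathbb{K},E\}$, $T^{Y}\colon Y^{\Omega}\supset\operatorname{dom}T^{Y}\to Y^{\omega}$ is linear, $\operatorname{AP}(\Omega,Y)\subset Y^{\Omega}$ is a linear subspace, $F(\Omega,Y)=\operatorname{AP}(\Omega,Y)\cap\operatorname{dom}T^{Y}$ (and $F(\Omega)=F(\Omega,\mathbb{K})$) is equipped with some locally convex Hausdorff topology, with $\delta_x\in F(\Omega)'$ for all $x\in\Omega$, and \[ \mathcal{F}\nu(\Omega,Y)=\{f\in F(\Omega,Y)\;|\;\forall\alpha:\ |f|_{\alpha}:=\sup_{x\in\omega}p_\alpha(T^{Y}(f)(x))\nu(x)<\infty\} \] carries the topology of the seminorms $|\cdot|_\alpha$; $\mathcal{F}\nu(\Omega)=\mathcal{F}\nu(\Omega,\mathbb{K})$. $(T^{E},T^{\mathbb{K}})$ is a generator for $(\mathcal{F}\nu,E)$ if $\mathcal{F}\nu(\Omega)$ and $\mathcal{F}\nu(\Omega,E)$ are Hausdorff (with directed systems of seminorms) and $\delta_x\in\mathcal{F}\nu(\Omega)'$ for all $x\in\Omega$. Put $T^{\mathbb{K}}_x:=\delta_x\circ T^{\mathbb{K}}$, $x\in\omega$. $F(\Omega)$ and $F(\Omega,E)$ are $\varepsilon$-into-compatible if $S\colon F(\Omega)\varepsilon E\to F(\Omega,E)$, $u\mapsto[x\mapsto u(\delta_x)]$, is a well-defined topological isomorphism onto its range. $(T^{E},T^{\mathbb{K}})$ is consistent for $(F,E)$ if for all $u\in F(\Omega)\varepsilon E$, $x\in\omega$: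 $S(u)\in F(\Omega,E)$, $T^{\mathbb{K}}_x\in F(\Omega)'$, $T^{E}(S(u))(x)=u(T^{\mathbb{K}}_x)$; strong if for all $e'\in E'$, $f\in F(\Omega,E)$, $x\in\omega$: $e'\circ f\in F(\Omega)$ and $T^{\mathbb{K}}(e'\circ f)(x)=e'(T^{E}(f)(x))$. $\mathcal{F}_{\varepsilon}\nu(\Omega,E):=S(\{u\in F(\Omega)\varepsilon E\;|\;u(B^{\circ})\text{ is bounded in }E\})$ where $B^{\circ}:=\{y'\in F(\Omega)'\;|\;\forall f\in B_{\mathcal{F}\nu(\Omega)}:\ |y'(f)|\le1\}$. $U\subset\omega$ is a set of uniqueness for $(T^{\mathbb{K}},\mathcal{F}\nu)$ if $T^{\mathbb{K}}_x\in\mathcal{F}\nu(\Omega)'$ for all $x\in U$ and $f\in\mathcal{F}\nu(\Omega)$, $T^{\mathbb{K}}(f)=0$ on $U$ implies $f=0$. $\mathcal{F}\nu_{G}(U,E)$ is the space of functions $f\colon U\to E$ such that for every $e'\in G$ there is $f_{e'}\in\mathcal{F}\nu(\Omega)$ with $T^{\mathbb{K}}(f_{e'})(x)=(e'\circ f)(x)$ for all $x\in U$. *)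

theory Defs
  imports "HOL-Analysis.Analysis" "HOL-Library.Function_Algebras"
begin

section \<open>The scalar field\<close>

text \<open>A copy of the real or of the complex numbers, as a field with absolute value.\<close>

class real_or_complex = real_normed_field +
  assumes real_or_complex:
    "(\<exists>\<phi>::'a \<Rightarrow> real. bij \<phi> \<and> (\<forall>x y. \<phi> (x + y) = \<phi> x + \<phi> y) \<and>
        (\<forall>x y. \<phi> (x * y) = \<phi> x * \<phi> y) \<and> (\<forall>x. norm (\<phi> x) = norm x)) \<or>
     (\<exists>\<phi>::'a \<Rightarrow> complex. bij \<phi> \<and> (\<forall>x y. \<phi> (x + y) = \<phi> x + \<phi> y) \<and>
        (\<forall>x y. \<phi> (x * y) = \<phi> x * \<phi> y) \<and> (\<forall>x. norm (\<phi> x) = norm x))"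

instance real :: real_or_complex
  by standard (rule disjI1, rule exI[of _ "\<lambda>x. x"], simp add: bij_id[unfolded id_def])

instance complex :: real_or_complex
  by standard (rule disjI2, rule exI[of _ "\<lambda>x. x"], simp add: bij_id[unfolded id_def])


section \<open>Locally convex spaces\<close>

text \<open>A vector space is a subspace \<open>V\<close> of an ambient abelian group type with a scalar
  multiplication \<open>s\<close>; a topological vector space is given by \<open>s\<close> and a topology whose
  \<^const>\<open>topspace\<close> is the space. Function spaces carry the pointwise operations.\<close>

definition fun_scale :: "('k \<Rightarrow> 'v \<Rightarrow> 'v) \<Rightarrow> 'k \<Rightarrow> ('a \<Rightarrow> 'v) \<Rightarrow> 'a \<Rightarrow> 'v" where
  "fun_scale s c f = (\<lambda>x. s c (f x))"

abbreviation scalar_fun_scale :: "'k::real_normed_field \<Rightarrow> ('a \<Rightarrow> 'k) \<Rightarrow> 'a \<Rightarrow> 'k" where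
  "scalar_fun_scale \<equiv> fun_scale (*)"

definition linear_on ::
  "('k \<Rightarrow> 'v::ab_group_add \<Rightarrow> 'v) \<Rightarrow> ('k \<Rightarrow> 'w::ab_group_add \<Rightarrow> 'w) \<Rightarrow> 'v set \<Rightarrow> ('v \<Rightarrow> 'w) \<Rightarrow> bool" where
  "linear_on s t V f \<longleftrightarrow>
     (\<forall>x\<in>V. \<forall>y\<in>V. f (x + y) = f x + f y) \<and> (\<forall>c. \<forall>x\<in>V. f (s c x) = t c (f x))"

definition seminorm_on ::
  "('k::real_normed_field \<Rightarrow> 'v::ab_group_add \<Rightarrow> 'v) \<Rightarrow> 'v set \<Rightarrow> ('v \<Rightarrow> real) \<Rightarrow> bool" where
  "seminorm_on s V p \<longleftrightarrow> (\<forall>x\<in>V. 0 \<le> p x) \<and>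
     (\<forall>x\<in>V. \<forall>y\<in>V. p (x + y) \<le> p x + p y) \<and> (\<forall>c. \<forall>x\<in>V. p (s c x) = norm c * p x)"

definition directed_seminorms :: "'v set \<Rightarrow> ('i \<Rightarrow> 'v \<Rightarrow> real) \<Rightarrow> bool" where
  "directed_seminorms V p \<longleftrightarrow>
     (\<forall>i j. \<exists>k C. \<forall>x\<in>V. p i x \<le> C * p k x \<and> p j x \<le> C * p k x)"

definition seminorm_topology :: "'v::ab_group_add set \<Rightarrow> ('v \<Rightarrow> real) set \<Rightarrow> 'v topology" where
  "seminorm_topology V P =
     topology_generated_by (insert V {{y \<in> V. p (y - x) < r} | p x r. p \<in> P \<and> x \<in> V \<and> 0 < r})"

definition locally_convex_Hausdorff ::
  "('k::real_normed_field \<Rightarrow> 'v::ab_group_add \<Rightarrow> 'v) \<Rightarrow> 'v topology \<Rightarrow> bool" where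
  "locally_convex_Hausdorff s T \<longleftrightarrow> module.subspace s (topspace T) \<and> Hausdorff_space T \<and>
     (\<exists>P. (\<forall>p\<in>P. seminorm_on s (topspace T) p) \<and> T = seminorm_topology (topspace T) P)"

text \<open>A non-trivial locally convex Hausdorff space on a whole type, with a directed system of
  seminorms generating its topology.\<close>

definition lcHs :: "('k::real_normed_field \<Rightarrow> 'e::ab_group_add \<Rightarrow> 'e) \<Rightarrow> ('i \<Rightarrow> 'e \<Rightarrow> real) \<Rightarrow> bool" where
  "lcHs s p \<longleftrightarrow> vector_space s \<and> (\<exists>x::'e. x \<noteq> 0) \<and> (\<forall>i. seminorm_on s UNIV (p i)) \<and>
     directed_seminorms UNIV p \<and> Hausdorff_space (seminorm_topology UNIV (range p))"

definition bounded_wrt :: "('i \<Rightarrow> 'v \<Rightarrow> real) \<Rightarrow> 'v set \<Rightarrow> bool" where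
  "bounded_wrt p D \<longleftrightarrow> (\<forall>i. bdd_above (p i ` D))"

definition absolutely_convex ::
  "('k::real_normed_field \<Rightarrow> 'v::ab_group_add \<Rightarrow> 'v) \<Rightarrow> 'v set \<Rightarrow> bool" where
  "absolutely_convex s D \<longleftrightarrow> D \<noteq> {} \<and>
     (\<forall>x\<in>D. \<forall>y\<in>D. \<forall>a b. norm a + norm b \<le> 1 \<longrightarrow> s a x + s b y \<in> D)"

definition banach_on ::
  "('k::real_normed_field \<Rightarrow> 'v::ab_group_add \<Rightarrow> 'v) \<Rightarrow> 'v set \<Rightarrow> ('v \<Rightarrow> real) \<Rightarrow> bool" where
  "banach_on s V N \<longleftrightarrow> module.subspace s V \<and> seminorm_on s V N \<and> (\<forall>x\<in>V. N x = 0 \<longrightarrow> x = 0) \<and>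
     (\<forall>\<sigma>::nat \<Rightarrow> 'v. (\<forall>n. \<sigma> n \<in> V) \<and> (\<forall>e>0. \<exists>M. \<forall>m\<ge>M. \<forall>n\<ge>M. N (\<sigma> m - \<sigma> n) < e)
        \<longrightarrow> (\<exists>l\<in>V. (\<lambda>n. N (\<sigma> n - l)) \<longlonglongrightarrow> 0))"

definition minkowski_gauge ::
  "('k::real_normed_field \<Rightarrow> 'v::ab_group_add \<Rightarrow> 'v) \<Rightarrow> 'v set \<Rightarrow> 'v \<Rightarrow> real" where
  "minkowski_gauge s D x = Inf {t. 0 < t \<and> x \<in> s (of_real t) ` D}"

definition locally_complete ::
  "('k::real_normed_field \<Rightarrow> 'e::ab_group_add \<Rightarrow> 'e) \<Rightarrow> ('i \<Rightarrow> 'e \<Rightarrow> real) \<Rightarrow> bool" where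
  "locally_complete s p \<longleftrightarrow>
     (\<forall>D. closedin (seminorm_topology UNIV (range p)) D \<and> bounded_wrt p D \<and> absolutely_convex s D
        \<longrightarrow> banach_on s (\<Union>n::nat. s (of_nat n) ` D) (minkowski_gauge s D))"


section \<open>Duals and the epsilon-product\<close>

text \<open>Maps defined on a subspace are represented by total functions vanishing off the subspace, so
  that equality of maps is equality of functions and pointwise operations stay inside the
  representing set.\<close>

definition restrict0 :: "'v set \<Rightarrow> ('v \<Rightarrow> 'w::zero) \<Rightarrow> 'v \<Rightarrow> 'w" where
  "restrict0 V f = (\<lambda>x. if x \<in> V then f x else 0)"

definition dual ::
  "('k::real_normed_field \<Rightarrow> 'v::ab_group_add \<Rightarrow> 'v) \<Rightarrow> 'v topology \<Rightarrow> ('v \<Rightarrow> 'k) set" where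
  "dual s T = {\<phi>. linear_on s (*) (topspace T) \<phi> \<and> continuous_map T euclidean \<phi> \<and>
     (\<forall>x. x \<notin> topspace T \<longrightarrow> \<phi> x = 0)}"

definition kappa_topology ::
  "('k::real_normed_field \<Rightarrow> 'v::ab_group_add \<Rightarrow> 'v) \<Rightarrow> 'v topology \<Rightarrow> ('v \<Rightarrow> 'k) topology" where
  "kappa_topology s T = seminorm_topology (dual s T)
     {\<lambda>\<phi>. SUP x\<in>K. norm (\<phi> x) | K. absolutely_convex s K \<and> compactin T K}"

definition equicontinuous_on_top :: "'v topology \<Rightarrow> ('v \<Rightarrow> 'k::real_normed_field) set \<Rightarrow> bool" where
  "equicontinuous_on_top T H \<longleftrightarrow> (\<forall>x\<in>topspace T. \<forall>e>0. \<exists>W. openin T W \<and> x \<in> W \<and>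
     (\<forall>\<phi>\<in>H. \<forall>y\<in>W. norm (\<phi> y - \<phi> x) < e))"

definition eps_product ::
  "('k::real_normed_field \<Rightarrow> 'v::ab_group_add \<Rightarrow> 'v) \<Rightarrow> 'v topology \<Rightarrow>
   ('k \<Rightarrow> 'e::ab_group_add \<Rightarrow> 'e) \<Rightarrow> ('i \<Rightarrow> 'e \<Rightarrow> real) \<Rightarrow> (('v \<Rightarrow> 'k) \<Rightarrow> 'e) set" where
  "eps_product s T sE p = {u. linear_on scalar_fun_scale sE (dual s T) u \<and>
     continuous_map (kappa_topology s T) (seminorm_topology UNIV (range p)) u \<and>
     (\<forall>\<phi>. \<phi> \<notin> dual s T \<longrightarrow> u \<phi> = 0)}"

definition eps_topology ::
  "('k::real_normed_field \<Rightarrow> 'v::ab_group_add \<Rightarrow> 'v) \<Rightarrow> 'v topology \<Rightarrow>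
   ('k \<Rightarrow> 'e::ab_group_add \<Rightarrow> 'e) \<Rightarrow> ('i \<Rightarrow> 'e \<Rightarrow> real) \<Rightarrow> (('v \<Rightarrow> 'k) \<Rightarrow> 'e) topology" where
  "eps_topology s T sE p = seminorm_topology (eps_product s T sE p)
     {\<lambda>u. SUP \<phi>\<in>H. p i (u \<phi>) | i H. H \<noteq> {} \<and> H \<subseteq> dual s T \<and> equicontinuous_on_top T H}"

definition determines_boundedness :: "('i \<Rightarrow> 'e \<Rightarrow> real) \<Rightarrow> ('e \<Rightarrow> 'k::real_normed_field) set \<Rightarrow> bool" where
  "determines_boundedness p G \<longleftrightarrow>
     (\<forall>D. (\<forall>e'\<in>G. bounded (e' ` D)) \<longrightarrow> bounded_wrt p D)"


section \<open>Spaces of functions\<close>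

text \<open>The sets \<open>\<Omega>\<close> and \<open>\<omega>\<close> are the types \<open>'x\<close> and \<open>'o\<close>. In the following, \<open>FT\<close> is the topology
  of the scalar-valued space \<open>F(\<Omega>)\<close> and \<open>FET\<close> that of \<open>F(\<Omega>,E)\<close>.\<close>

definition point_eval :: "('x \<Rightarrow> 'k::real_normed_field) set \<Rightarrow> 'x \<Rightarrow> ('x \<Rightarrow> 'k) \<Rightarrow> 'k" where
  "point_eval V x = restrict0 V (\<lambda>f. f x)"

definition point_eval_T ::
  "('x \<Rightarrow> 'k::real_normed_field) set \<Rightarrow> (('x \<Rightarrow> 'k) \<Rightarrow> 'o \<Rightarrow> 'k) \<Rightarrow> 'o \<Rightarrow> ('x \<Rightarrow> 'k) \<Rightarrow> 'k" where
  "point_eval_T V TK x = restrict0 V (\<lambda>f. TK f x)"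

definition S_map ::
  "('x \<Rightarrow> 'k::real_normed_field) topology \<Rightarrow> ((('x \<Rightarrow> 'k) \<Rightarrow> 'k) \<Rightarrow> 'e) \<Rightarrow> 'x \<Rightarrow> 'e" where
  "S_map FT u = (\<lambda>x. u (point_eval (topspace FT) x))"

definition eps_into_compatible ::
  "('k::real_normed_field \<Rightarrow> 'e::ab_group_add \<Rightarrow> 'e) \<Rightarrow> ('i \<Rightarrow> 'e \<Rightarrow> real) \<Rightarrow>
   ('x \<Rightarrow> 'k) topology \<Rightarrow> ('x \<Rightarrow> 'e) topology \<Rightarrow> bool" where
  "eps_into_compatible sE p FT FET \<longleftrightarrow>
     S_map FT ` eps_product scalar_fun_scale FT sE p \<subseteq> topspace FET \<and>
     linear_on (fun_scale sE) (fun_scale sE) (eps_product scalar_fun_scale FT sE p) (S_map FT) \<and>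
     embedding_map (eps_topology scalar_fun_scale FT sE p) FET (S_map FT)"

definition weighted_seminorm ::
  "(('x \<Rightarrow> 'y) \<Rightarrow> 'o \<Rightarrow> 'y) \<Rightarrow> ('o \<Rightarrow> real) \<Rightarrow> ('i \<Rightarrow> 'y \<Rightarrow> real) \<Rightarrow> 'i \<Rightarrow> ('x \<Rightarrow> 'y) \<Rightarrow> real" where
  "weighted_seminorm T \<nu> q i f = (SUP x. q i (T f x) * \<nu> x)"

definition weighted_space ::
  "('x \<Rightarrow> 'y) set \<Rightarrow> (('x \<Rightarrow> 'y) \<Rightarrow> 'o \<Rightarrow> 'y) \<Rightarrow> ('o \<Rightarrow> real) \<Rightarrow> ('i \<Rightarrow> 'y \<Rightarrow> real) \<Rightarrow> ('x \<Rightarrow> 'y) set" where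
  "weighted_space F T \<nu> q = {f \<in> F. \<forall>i. bdd_above (range (\<lambda>x. q i (T f x) * \<nu> x))}"

definition weighted_topology ::
  "('x \<Rightarrow> 'y::ab_group_add) set \<Rightarrow> (('x \<Rightarrow> 'y) \<Rightarrow> 'o \<Rightarrow> 'y) \<Rightarrow> ('o \<Rightarrow> real) \<Rightarrow> ('i \<Rightarrow> 'y \<Rightarrow> real) \<Rightarrow>
   ('x \<Rightarrow> 'y) topology" where
  "weighted_topology F T \<nu> q =
     seminorm_topology (weighted_space F T \<nu> q) (range (weighted_seminorm T \<nu> q))"

text \<open>The scalar field carries the one-element system of seminorms consisting of the norm.\<close>

abbreviation norm_system :: "unit \<Rightarrow> 'k::real_normed_field \<Rightarrow> real" where
  "norm_system \<equiv> (\<lambda>_. norm)"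

definition generator ::
  "('i \<Rightarrow> 'e::ab_group_add \<Rightarrow> real) \<Rightarrow> ('o \<Rightarrow> real) \<Rightarrow>
   ('x \<Rightarrow> 'k::real_normed_field) set \<Rightarrow> (('x \<Rightarrow> 'k) \<Rightarrow> 'o \<Rightarrow> 'k) \<Rightarrow>
   ('x \<Rightarrow> 'e) set \<Rightarrow> (('x \<Rightarrow> 'e) \<Rightarrow> 'o \<Rightarrow> 'e) \<Rightarrow> bool" where
  "generator p \<nu> FK TK FE TE \<longleftrightarrow>
     Hausdorff_space (weighted_topology FK TK \<nu> norm_system) \<and>
     directed_seminorms (weighted_space FK TK \<nu> norm_system) (weighted_seminorm TK \<nu> norm_system) \<and>
     Hausdorff_space (weighted_topology FE TE \<nu> p) \<and>
     directed_seminorms (weighted_space FE TE \<nu> p) (weighted_seminorm TE \<nu> p) \<and>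
     (\<forall>x. point_eval (weighted_space FK TK \<nu> norm_system) x
        \<in> dual scalar_fun_scale (weighted_topology FK TK \<nu> norm_system))"

definition consistent ::
  "('k::real_normed_field \<Rightarrow> 'e::ab_group_add \<Rightarrow> 'e) \<Rightarrow> ('i \<Rightarrow> 'e \<Rightarrow> real) \<Rightarrow>
   ('x \<Rightarrow> 'k) topology \<Rightarrow> (('x \<Rightarrow> 'k) \<Rightarrow> 'o \<Rightarrow> 'k) \<Rightarrow>
   ('x \<Rightarrow> 'e) topology \<Rightarrow> (('x \<Rightarrow> 'e) \<Rightarrow> 'o \<Rightarrow> 'e) \<Rightarrow> bool" where
  "consistent sE p FT TK FET TE \<longleftrightarrow>
     (\<forall>u \<in> eps_product scalar_fun_scale FT sE p. \<forall>x.
        S_map FT u \<in> topspace FET \<and>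
        point_eval_T (topspace FT) TK x \<in> dual scalar_fun_scale FT \<and>
        TE (S_map FT u) x = u (point_eval_T (topspace FT) TK x))"

definition strong ::
  "('k::real_normed_field \<Rightarrow> 'e::ab_group_add \<Rightarrow> 'e) \<Rightarrow> ('i \<Rightarrow> 'e \<Rightarrow> real) \<Rightarrow>
   ('x \<Rightarrow> 'k) set \<Rightarrow> (('x \<Rightarrow> 'k) \<Rightarrow> 'o \<Rightarrow> 'k) \<Rightarrow>
   ('x \<Rightarrow> 'e) set \<Rightarrow> (('x \<Rightarrow> 'e) \<Rightarrow> 'o \<Rightarrow> 'e) \<Rightarrow> bool" where
  "strong sE p FK TK FE TE \<longleftrightarrow>
     (\<forall>e' \<in> dual sE (seminorm_topology UNIV (range p)). \<forall>f\<in>FE. \<forall>x.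
        e' \<circ> f \<in> FK \<and> TK (e' \<circ> f) x = e' (TE f x))"

definition unit_ball ::
  "('x \<Rightarrow> 'k::real_normed_field) set \<Rightarrow> (('x \<Rightarrow> 'k) \<Rightarrow> 'o \<Rightarrow> 'k) \<Rightarrow> ('o \<Rightarrow> real) \<Rightarrow> ('x \<Rightarrow> 'k) set" where
  "unit_ball FK TK \<nu> =
     {f \<in> weighted_space FK TK \<nu> norm_system. weighted_seminorm TK \<nu> norm_system () f \<le> 1}"

definition polar ::
  "('k::real_normed_field \<Rightarrow> 'v::ab_group_add \<Rightarrow> 'v) \<Rightarrow> 'v topology \<Rightarrow> 'v set \<Rightarrow> ('v \<Rightarrow> 'k) set" where
  "polar s T B = {y \<in> dual s T. \<forall>f\<in>B. norm (y f) \<le> 1}"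

definition F_eps ::
  "('k::real_normed_field \<Rightarrow> 'e::ab_group_add \<Rightarrow> 'e) \<Rightarrow> ('i \<Rightarrow> 'e \<Rightarrow> real) \<Rightarrow> ('o \<Rightarrow> real) \<Rightarrow>
   ('x \<Rightarrow> 'k) topology \<Rightarrow> (('x \<Rightarrow> 'k) \<Rightarrow> 'o \<Rightarrow> 'k) \<Rightarrow> ('x \<Rightarrow> 'e) set" where
  "F_eps sE p \<nu> FT TK = S_map FT ` {u \<in> eps_product scalar_fun_scale FT sE p.
     bounded_wrt p (u ` polar scalar_fun_scale FT (unit_ball (topspace FT) TK \<nu>))}"

definition set_of_uniqueness ::
  "('x \<Rightarrow> 'k::real_normed_field) set \<Rightarrow> (('x \<Rightarrow> 'k) \<Rightarrow> 'o \<Rightarrow> 'k) \<Rightarrow> ('o \<Rightarrow> real) \<Rightarrow> 'o set \<Rightarrow> bool" where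
  "set_of_uniqueness FK TK \<nu> U \<longleftrightarrow>
     (\<forall>x\<in>U. point_eval_T (weighted_space FK TK \<nu> norm_system) TK x
        \<in> dual scalar_fun_scale (weighted_topology FK TK \<nu> norm_system)) \<and>
     (\<forall>f \<in> weighted_space FK TK \<nu> norm_system. (\<forall>x\<in>U. TK f x = 0) \<longrightarrow> f = 0)"

text \<open>A function \<open>U \<rightarrow> E\<close> is an element of \<^term>\<open>extensional U\<close>.\<close>

definition F_G ::
  "('x \<Rightarrow> 'k::real_normed_field) set \<Rightarrow> (('x \<Rightarrow> 'k) \<Rightarrow> 'o \<Rightarrow> 'k) \<Rightarrow> ('o \<Rightarrow> real) \<Rightarrow>
   ('e \<Rightarrow> 'k) set \<Rightarrow> 'o set \<Rightarrow> ('o \<Rightarrow> 'e) set" where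
  "F_G FK TK \<nu> G U = {f \<in> extensional U. \<forall>e'\<in>G. \<exists>g \<in> weighted_space FK TK \<nu> norm_system.
     \<forall>x\<in>U. TK g x = (e' \<circ> f) x}"

definition restriction_map ::
  "(('x \<Rightarrow> 'e) \<Rightarrow> 'o \<Rightarrow> 'e) \<Rightarrow> 'o set \<Rightarrow> ('x \<Rightarrow> 'e) \<Rightarrow> 'o \<Rightarrow> 'e" where
  "restriction_map TE U f = restrict (TE f) U"

end

theory Submission imports Defs begin

text \<open>
  For \<open>h\<close> in \<open>F_G\<close> choose \<open>g e' \<in> \<F>\<nu>(\<Omega>)\<close> for every \<open>e' \<in> G\<close> and let \<open>u y\<close> be the unique \<open>e\<close>
  with \<open>e' e = y (g e')\<close> for all \<open>e' \<in> G\<close>; uniqueness holds because \<open>G\<close> separates points. Linearity of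
  \<open>u\<close> and boundedness of \<open>u\<close> on the polar of the unit ball \<open>B\<close>, hence \<open>\<kappa>\<close>-continuity, are then
  immediate from the definition. Existence is clear when \<open>y\<close> is a linear combination of the \<open>T\<^sub>x\<close>,
  \<open>x \<in> U\<close>. These are dense in the dual for uniform convergence on \<open>B\<close>, since \<open>B\<close> is compact and
  \<open>U\<close> is a set of uniqueness; local completeness of \<open>E\<close> supplies the limits.
\<close>

section \<open>Real and imaginary parts of scalars\<close>

text \<open>Both alternatives of the class are sent into \<open>complex\<close>, so that one
  argument serves both fields. The last clause keeps track of which complex numbers are available as
  multipliers.\<close>

lemma real_or_complex_embedding:
  obtains \<phi> :: "'k::real_or_complex \<Rightarrow> complex"
  where "\<And>x y. \<phi> (x + y) = \<phi> x + \<phi> y" "\<And>x y. \<phi> (x * y) = \<phi> x * \<phi> y"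
    "\<And>x. norm (\<phi> x) = norm x" "surj \<phi> \<or> range \<phi> = range complex_of_real"
  using real_or_complex[where 'a = 'k]
proof (elim disjE exE conjE)
  fix \<psi> :: "'k \<Rightarrow> real"
  assume \<psi>: "bij \<psi>" "\<forall>x y. \<psi> (x + y) = \<psi> x + \<psi> y" "\<forall>x y. \<psi> (x * y) = \<psi> x * \<psi> y"
    "\<forall>x. norm (\<psi> x) = norm x"
  have "range (complex_of_real \<circ> \<psi>) = range complex_of_real"
    using bij_is_surj[OF \<psi>(1)] by (simp only: image_comp[symmetric])
  then show thesis
    using \<psi> by (intro that[of "complex_of_real \<circ> \<psi>"]) auto
next
  fix \<psi> :: "'k \<Rightarrow> complex"
  assume "bij \<psi>" "\<forall>x y. \<psi> (x + y) = \<psi> x + \<psi> y" "\<forall>x y. \<psi> (x * y) = \<psi> x * \<psi> y"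
    "\<forall>x. norm (\<psi> x) = norm x"
  then show thesis
    by (intro that[of \<psi>]) (auto simp: bij_is_surj)
qed

text \<open>The interface through which the Hahn-Banach argument below sees the field. For a copy of
  the reals \<open>\<iota>\<close> vanishes, and the clause on \<open>\<alpha>\<close> and
  \<open>\<beta>\<close> then holds with the multiplier corresponding to
  \<open>\<alpha>\<close>.\<close>

lemma real_and_imaginary_part:
  obtains \<rho> \<iota> :: "'k::real_or_complex \<Rightarrow> real"
  where "\<And>x y. \<rho> (x + y) = \<rho> x + \<rho> y" "\<And>x y. \<iota> (x + y) = \<iota> x + \<iota> y"
    "\<And>r x. \<rho> (of_real r * x) = r * \<rho> x" "\<And>r x. \<iota> (of_real r * x) = r * \<iota> x"
    "\<And>z. \<rho> z = 0 \<Longrightarrow> \<iota> z = 0 \<Longrightarrow> z = 0"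
    "\<And>\<alpha> \<beta>. \<exists>a. \<forall>z. \<rho> (a * z) = \<alpha> * \<rho> z + \<beta> * \<iota> z"
    "\<And>z. \<rho> z \<le> norm z" "\<And>z. \<exists>c. norm c = 1 \<and> \<rho> (c * z) = norm z"
proof -
  obtain \<phi> :: "'k \<Rightarrow> complex" where \<phi>: "\<And>x y. \<phi> (x + y) = \<phi> x + \<phi> y"
    "\<And>x y. \<phi> (x * y) = \<phi> x * \<phi> y" "\<And>x. norm (\<phi> x) = norm x"
    "surj \<phi> \<or> range \<phi> = range complex_of_real"
    by (rule real_or_complex_embedding, rule that)
  have one: "\<phi> 1 = 1"
    using \<phi>(2)[of 1 1] \<phi>(3)[of 1] by auto
  have minus: "\<phi> (x - y) = \<phi> x - \<phi> y" for x y
    using \<phi>(1)[of "x - y" y] by (simp add: algebra_simps)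
  \<comment> \<open>The class does not state that the embedding is real-linear. The image of r has
    distance \<bar>r\<bar> from 0 and \<bar>r - 1\<bar> from 1, and these two circles meet only in
    r.\<close>
  have of_real: "\<phi> (of_real r) = of_real r" for r
  proof -
    define z where "z = \<phi> (of_real r)"
    have 1: "(cmod z)\<^sup>2 = r\<^sup>2"
      using \<phi>(3)[of "of_real r"] by (simp add: z_def)
    have "cmod (z - 1) = \<bar>r - 1\<bar>"
      using \<phi>(3)[of "of_real r - 1"] norm_of_real[of "r - 1", where 'a = 'k] by (simp add: minus one z_def)
    then have 2: "(cmod (z - 1))\<^sup>2 = (r - 1)\<^sup>2"
      by simp
    have "Re z = r"
      using 1 2 unfolding cmod_power2 by (simp add: power2_eq_square algebra_simps)
    moreover from this have "Im z = 0"
      using 1 by (simp add: cmod_power2)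
    ultimately show ?thesis
      by (simp add: z_def complex_eq_iff)
  qed
  show thesis
  proof (rule that[of "\<lambda>z. Re (\<phi> z)" "\<lambda>z. Im (\<phi> z)"])
    show "z = 0" if "Re (\<phi> z) = 0" "Im (\<phi> z) = 0" for z
      using that \<phi>(3)[of z] by (metis complex_eq_iff norm_eq_zero zero_complex.simps)
    \<comment> \<open>The multiplier comes from Re ((\<alpha> - i\<beta>)(x + iy)) = \<alpha>x +
      \<beta>y.\<close>
    show "\<exists>a. \<forall>z. Re (\<phi> (a * z)) = \<alpha> * Re (\<phi> z) + \<beta> * Im (\<phi> z)" for \<alpha> \<beta>
      using \<phi>(4)
    proof
      assume "surj \<phi>"
      then obtain a where "\<phi> a = Complex \<alpha> (- \<beta>)"
        by (metis surjD)
      then show ?thesis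
        by (intro exI[of _ a]) (simp add: \<phi>(2))
    next
      assume r: "range \<phi> = range complex_of_real"
      then obtain a where a: "\<phi> a = of_real \<alpha>"
        by (metis imageE rangeI)
      have "Im (\<phi> z) = 0" for z
        using r by (metis Im_complex_of_real imageE rangeI)
      then show ?thesis
        by (intro exI[of _ a]) (simp add: \<phi>(2) a)
    qed
    show "Re (\<phi> z) \<le> norm z" for z
      using complex_Re_le_cmod[of "\<phi> z"] \<phi>(3) by simp
    show "\<exists>c. norm c = 1 \<and> Re (\<phi> (c * z)) = norm z" for z
    proof (cases "z = 0")
      case True
      then show ?thesis
        using \<phi>(3)[of 0] by (intro exI[of _ 1]) simp
    next
      case False
      then show ?thesis
        by (intro exI[of _ "of_real (norm z) / z"]) (simp add: norm_divide of_real)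
    qed
  qed (simp_all add: \<phi> of_real)
qed

section \<open>Finite Hahn-Banach approximation on an absolutely convex set\<close>

text \<open>A suitable \<alpha> has to separate the lower bounds (h x - \<epsilon>) / g x from the
  upper bounds (h y + \<epsilon>) / g y over points where \<open>g\<close> is positive; the supremum
  of the lower bounds does. The term \<open>c a b x y\<close> stands for a real combination a x + b
  y, which avoids a real vector space structure.\<close>

lemma real_functional_minus_multiple_le:
  fixes h g :: "'v \<Rightarrow> real" and c :: "real \<Rightarrow> real \<Rightarrow> 'v \<Rightarrow> 'v \<Rightarrow> 'v"
  assumes c: "\<And>x y a b. x \<in> B \<Longrightarrow> y \<in> B \<Longrightarrow> \<bar>a\<bar> + \<bar>b\<bar> \<le> 1 \<Longrightarrow> c a b x y \<in> B"
    and h: "\<And>x y a b. x \<in> B \<Longrightarrow> y \<in> B \<Longrightarrow> h (c a b x y) = a * h x + b * h y"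
    and g: "\<And>x y a b. x \<in> B \<Longrightarrow> y \<in> B \<Longrightarrow> g (c a b x y) = a * g x + b * g y"
    and le: "\<And>x. x \<in> B \<Longrightarrow> g x = 0 \<Longrightarrow> h x \<le> \<epsilon>"
  shows "\<exists>\<alpha>. \<forall>x\<in>B. h x - \<alpha> * g x \<le> \<epsilon>"
proof (cases "\<exists>x\<in>B. g x > 0")
  case False
  \<comment> \<open>\<open>c (-1) 0 x x\<close> plays the role of -x, so a negative value of
    \<open>g\<close> on \<open>B\<close> would yield a positive one.\<close>
  have "g x = 0" if "x \<in> B" for x
    using False that c[OF that that, of "-1" 0] g[OF that that, of "-1" 0]
    by (metis abs_minus_cancel abs_one abs_zero add.right_neutral linorder_neqE_linordered_idom mult_minus1 mult_zero_left neg_0_less_iff_less order_refl)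
  then show ?thesis
    using le by auto
next
  case True
  have key: "(h x - \<epsilon>) / g x \<le> (h y + \<epsilon>) / g y" if "x \<in> B" "y \<in> B" "g x > 0" "g y > 0" for x y
  proof -
    \<comment> \<open>These weights place the combination of \<open>x\<close> and \<open>y\<close>
      in the kernel of \<open>g\<close>, with absolute values summing to 1, so that
      \<open>le\<close> applies to it.\<close>
    define a b where "a = g y / (g x + g y)" and "b = - (g x / (g x + g y))"
    have *: "\<bar>a\<bar> + \<bar>b\<bar> \<le> 1"
      using that by (simp add: a_def b_def add_divide_distrib[symmetric])
    have "a * g x + b * g y = 0"
      by (simp add: a_def b_def)
    then have "a * h x + b * h y \<le> \<epsilon>"
      using le[OF c[OF that(1,2) *]] h[OF that(1,2)] g[OF that(1,2)] by simp
    moreover have "a * h x + b * h y = (g y * h x - g x * h y) / (g x + g y)"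
      by (simp add: a_def b_def diff_divide_distrib)
    ultimately have "g y * h x - g x * h y \<le> \<epsilon> * (g x + g y)"
      using that by (simp add: pos_divide_le_eq)
    then show ?thesis
      using that by (simp add: frac_le_eq field_simps)
  qed
  define S where "S = (\<lambda>x. (h x - \<epsilon>) / g x) ` {x \<in> B. g x > 0}"
  have S: "S \<noteq> {}"
    using True by (auto simp: S_def)
  obtain z where "z \<in> B" "g z > 0"
    using True by blast
  then have bdd: "bdd_above S"
    unfolding S_def by (intro bdd_aboveI[of _ "(h z + \<epsilon>) / g z"]) (auto intro: key)
  \<comment> \<open>The second inequality, taken at the reflected point, covers the points where
    \<open>g\<close> is negative.\<close>
  have pos: "h x - Sup S * g x \<le> \<epsilon> \<and> - h x + Sup S * g x \<le> \<epsilon>" if "x \<in> B" "g x > 0" for x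
  proof -
    have "(h x - \<epsilon>) / g x \<le> Sup S"
      using that bdd by (intro cSup_upper) (auto simp: S_def)
    moreover have "Sup S \<le> (h x + \<epsilon>) / g x"
      using that by (intro cSup_least[OF S]) (auto simp: S_def intro: key)
    ultimately show ?thesis
      using that by (simp add: divide_le_eq pos_le_divide_eq algebra_simps)
  qed
  have "h x - Sup S * g x \<le> \<epsilon>" if "x \<in> B" for x
  proof -
    consider "g x > 0" | "g x = 0" | "g x < 0"
      by linarith
    then show ?thesis
    proof cases
      case 3
      then show ?thesis
        using pos[of "c (-1) 0 x x"] c[OF that that, of "-1" 0] h[OF that that, of "-1" 0]
          g[OF that that, of "-1" 0] by simp
    qed (use pos le that in auto)
  qed
  then show ?thesis
    by blast
qed

text \<open>The condition g x = 0 amounts to two real conditions. They are removed one after the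
  other by the real lemma, and a rotation turns the resulting bound on the real part into a bound on
  the norm.\<close>

lemma functional_minus_multiple_le:
  fixes y g :: "'v::ab_group_add \<Rightarrow> 'k::real_or_complex"
  assumes B: "absolutely_convex s B"
    and y: "\<And>x x' a b. x \<in> B \<Longrightarrow> x' \<in> B \<Longrightarrow> y (s a x + s b x') = a * y x + b * y x'"
    and g: "\<And>x x' a b. x \<in> B \<Longrightarrow> x' \<in> B \<Longrightarrow> g (s a x + s b x') = a * g x + b * g x'"
    and le: "\<And>x. x \<in> B \<Longrightarrow> g x = 0 \<Longrightarrow> norm (y x) \<le> \<epsilon>"
  shows "\<exists>a. \<forall>x\<in>B. norm (y x - a * g x) \<le> \<epsilon>"
proof -
  obtain \<rho> \<iota> :: "'k \<Rightarrow> real"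
    where r: "\<And>x y. \<rho> (x + y) = \<rho> x + \<rho> y" "\<And>x y. \<iota> (x + y) = \<iota> x + \<iota> y"
    "\<And>r x. \<rho> (of_real r * x) = r * \<rho> x" "\<And>r x. \<iota> (of_real r * x) = r * \<iota> x"
    "\<And>z. \<rho> z = 0 \<Longrightarrow> \<iota> z = 0 \<Longrightarrow> z = 0"
    "\<And>\<alpha> \<beta>. \<exists>a. \<forall>z. \<rho> (a * z) = \<alpha> * \<rho> z + \<beta> * \<iota> z"
    "\<And>z. \<rho> z \<le> norm z" "\<And>z. \<exists>c. norm c = 1 \<and> \<rho> (c * z) = norm z"
    by (rule real_and_imaginary_part, rule that)
  define c where "c a b u v = s (of_real a) u + s (of_real b) v" for a b u v
  have c: "c a b u v \<in> B" if "u \<in> B" "v \<in> B" "\<bar>a\<bar> + \<bar>b\<bar> \<le> 1" for a b u v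
    using B that by (simp add: absolutely_convex_def c_def)
  have cy: "y (c a b u v) = of_real a * y u + of_real b * y v" if "u \<in> B" "v \<in> B" for a b u v
    using y that by (simp add: c_def)
  have cg: "g (c a b u v) = of_real a * g u + of_real b * g v" if "u \<in> B" "v \<in> B" for a b u v
    using g that by (simp add: c_def)
  \<comment> \<open>First \<open>\<iota>\<close> of \<open>g\<close> is removed on the slice where
    \<open>\<rho>\<close> of \<open>g\<close> is zero; the next application removes
    \<open>\<rho>\<close> on all of \<open>B\<close>.\<close>
  have "\<exists>\<beta>. \<forall>x\<in>{x \<in> B. \<rho> (g x) = 0}. \<rho> (y x) - \<beta> * \<iota> (g x) \<le> \<epsilon>"
  proof (rule real_functional_minus_multiple_le[where c = c])
    show "\<rho> (y x) \<le> \<epsilon>" if "x \<in> {x \<in> B. \<rho> (g x) = 0}" "\<iota> (g x) = 0" for x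
      using that r(5)[of "g x"] le r(7)[of "y x"] by force
  qed (use c cy cg in \<open>auto simp: r\<close>)
  then obtain \<beta> where \<beta>: "\<And>x. x \<in> B \<Longrightarrow> \<rho> (g x) = 0 \<Longrightarrow> \<rho> (y x) - \<beta> * \<iota> (g x) \<le> \<epsilon>"
    by blast
  have "\<exists>\<alpha>. \<forall>x\<in>B. \<rho> (y x) - \<beta> * \<iota> (g x) - \<alpha> * \<rho> (g x) \<le> \<epsilon>"
    by (rule real_functional_minus_multiple_le[where c = c])
      (use c cy cg \<beta> in \<open>auto simp: r algebra_simps\<close>)
  then obtain \<alpha> where \<alpha>: "\<And>x. x \<in> B \<Longrightarrow> \<rho> (y x) - \<beta> * \<iota> (g x) - \<alpha> * \<rho> (g x) \<le> \<epsilon>"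
    by blast
  \<comment> \<open>The two real corrections combine into the real part of one multiple of
    \<open>g\<close>.\<close>
  obtain a where a: "\<And>z. \<rho> (a * z) = (- \<alpha>) * \<rho> z + (- \<beta>) * \<iota> z"
    using r(6) by blast
  have re: "\<rho> (y x + a * g x) \<le> \<epsilon>" if "x \<in> B" for x
    using \<alpha>[OF that] by (simp add: r a)
  have "norm (y x + a * g x) \<le> \<epsilon>" if "x \<in> B" for x
  proof -
    obtain d where d: "norm d = 1" "\<rho> (d * (y x + a * g x)) = norm (y x + a * g x)"
      using r(8) by blast
    \<comment> \<open>This is the rotated point d x, written as a two-term combination to match the
      form of absolute convexity.\<close>
    have "s d x + s 0 x \<in> B"
      using B that d by (simp add: absolutely_convex_def)
    from re[OF this] show ?thesis
      using d y[OF that that, of d 0] g[OF that that, of d 0] by (simp add: algebra_simps)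
  qed
  then show ?thesis
    by (intro exI[of _ "- a"]) simp
qed

text \<open>Induction on \<open>A\<close> with \<open>B\<close> arbitrary: the hypothesis is applied
  to the slice of \<open>B\<close> on which the new functional vanishes, and the previous lemma then
  extends the estimate from the slice to \<open>B\<close> at the cost of one more multiple.\<close>

lemma functional_minus_combination_le:
  fixes y :: "'v::ab_group_add \<Rightarrow> 'k::real_or_complex" and g :: "'o \<Rightarrow> 'v \<Rightarrow> 'k"
  assumes "finite A" "absolutely_convex s B"
    and "\<And>x x' a b. x \<in> B \<Longrightarrow> x' \<in> B \<Longrightarrow> y (s a x + s b x') = a * y x + b * y x'"
    and "\<And>j x x' a b. j \<in> A \<Longrightarrow> x \<in> B \<Longrightarrow> x' \<in> B \<Longrightarrow> g j (s a x + s b x') = a * g j x + b * g j x'"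
    and "\<And>x. x \<in> B \<Longrightarrow> \<forall>j\<in>A. g j x = 0 \<Longrightarrow> norm (y x) \<le> \<epsilon>"
  shows "\<exists>a. \<forall>x\<in>B. norm (y x - (\<Sum>j\<in>A. a j * g j x)) \<le> \<epsilon>"
  using assms
proof (induction A arbitrary: B rule: finite_induct)
  case empty
  then show ?case
    by simp
next
  case (insert i A)
  note lin = insert.prems(2,3)
  let ?B = "{x \<in> B. g i x = 0}"
  have "absolutely_convex s ?B"
    unfolding absolutely_convex_def
  proof (intro conjI ballI allI impI)
    obtain x where x: "x \<in> B"
      using insert.prems(1) by (auto simp: absolutely_convex_def)
    then have "s 0 x + s 0 x \<in> ?B"
      using insert.prems(1) lin(2)[of i x x 0 0] by (simp add: absolutely_convex_def)
    then show "?B \<noteq> {}"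
      by blast
  next
    fix x x' and a b :: 'k
    assume "x \<in> ?B" "x' \<in> ?B" "norm a + norm b \<le> 1"
    then show "s a x + s b x' \<in> ?B"
      using insert.prems(1) lin(2)[of i x x'] by (simp add: absolutely_convex_def)
  qed
  then have "\<exists>a. \<forall>x\<in>?B. norm (y x - (\<Sum>j\<in>A. a j * g j x)) \<le> \<epsilon>"
    by (rule insert.IH) (use insert.prems in auto)
  then obtain a where a: "\<And>x. x \<in> B \<Longrightarrow> g i x = 0 \<Longrightarrow> norm (y x - (\<Sum>j\<in>A. a j * g j x)) \<le> \<epsilon>"
    by auto
  have "\<exists>b. \<forall>x\<in>B. norm ((y x - (\<Sum>j\<in>A. a j * g j x)) - b * g i x) \<le> \<epsilon>"
  proof (rule functional_minus_multiple_le[OF insert.prems(1)])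
    fix x x' c d
    assume x: "x \<in> B" "x' \<in> B"
    have "(\<Sum>j\<in>A. a j * g j (s c x + s d x')) = (\<Sum>j\<in>A. c * (a j * g j x) + d * (a j * g j x'))"
      by (rule sum.cong) (use x lin(2) in \<open>auto simp: algebra_simps\<close>)
    then show "y (s c x + s d x') - (\<Sum>j\<in>A. a j * g j (s c x + s d x')) =
       c * (y x - (\<Sum>j\<in>A. a j * g j x)) + d * (y x' - (\<Sum>j\<in>A. a j * g j x'))"
      using lin(1)[OF x] by (simp add: sum.distrib sum_distrib_left algebra_simps)
  qed (use a lin(2) in auto)
  then obtain b where b: "\<forall>x\<in>B. norm ((y x - (\<Sum>j\<in>A. a j * g j x)) - b * g i x) \<le> \<epsilon>" ..
  have "(\<Sum>j\<in>insert i A. (a(i := b)) j * g j x) = b * g i x + (\<Sum>j\<in>A. a j * g j x)" for x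
  proof -
    have "(\<Sum>j\<in>A. (a(i := b)) j * g j x) = (\<Sum>j\<in>A. a j * g j x)"
      by (rule sum.cong) (use insert.hyps in auto)
    then show ?thesis
      using insert.hyps by simp
  qed
  then show ?case
    using b by (intro exI[of _ "a(i := b)"]) (simp add: algebra_simps)
qed

section \<open>Seminorm topologies and bounded sets\<close>

lemma topspace_seminorm_topology [simp]: "topspace (seminorm_topology V P) = V"
  by (auto simp: seminorm_topology_def)

lemma openin_seminorm_ball:
  "q \<in> P \<Longrightarrow> x \<in> V \<Longrightarrow> 0 < r \<Longrightarrow> openin (seminorm_topology V P) {y \<in> V. q (y - x) < r}"
  unfolding seminorm_topology_def by (rule topology_generated_by_Basis) blast

text \<open>The generating balls may have any centre; the triangle inequality recentres each of them
  at \<open>x\<close>, and a finite intersection is absorbed into a larger \<open>Q\<close> and a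
  smaller radius.\<close>

lemma seminorm_topology_neighbourhood:
  assumes P: "\<And>q. q \<in> P \<Longrightarrow> seminorm_on s UNIV q"
    and W: "openin (seminorm_topology UNIV P) W" "x \<in> W"
  shows "\<exists>Q r. finite Q \<and> Q \<subseteq> P \<and> 0 < r \<and> (\<forall>y. (\<forall>q\<in>Q. q (y - x) < r) \<longrightarrow> y \<in> W)"
proof -
  have "generate_topology_on (insert UNIV {{y \<in> UNIV. q (y - x) < r} | q x r. q \<in> P \<and> x \<in> UNIV \<and> 0 < r}) W"
    using W(1) unfolding seminorm_topology_def by (rule openin_topology_generated_by)
  then show ?thesis
    using W(2)
  proof induction
    case (Int A B)
    from Int.IH(1) Int.prems obtain Q r where
      Q: "finite Q" "Q \<subseteq> P" "0 < r" "\<forall>y. (\<forall>q\<in>Q. q (y - x) < r) \<longrightarrow> y \<in> A"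
      by blast
    from Int.IH(2) Int.prems obtain Q' r' where
      Q': "finite Q'" "Q' \<subseteq> P" "0 < r'" "\<forall>y. (\<forall>q\<in>Q'. q (y - x) < r') \<longrightarrow> y \<in> B"
      by blast
    show ?case
      using Q Q' by (intro exI[of _ "Q \<union> Q'"] exI[of _ "min r r'"]) auto
  next
    case (UN K)
    then obtain k where k: "k \<in> K" "x \<in> k"
      by blast
    show ?case
      using UN.IH[OF k] k(1) by blast
  next
    case (Basis A)
    then consider "A = UNIV" | q z r where "A = {y. q (y - z) < r}" "q \<in> P" "0 < r"
      by auto
    then show ?case
    proof cases
      case 1
      then show ?thesis
        by (intro exI[of _ "{}"] exI[of _ 1]) simp
    next
      case (2 q z r)
      have "y \<in> A" if "q (y - x) < r - q (x - z)" for y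
      proof -
        have "q ((y - x) + (x - z)) \<le> q (y - x) + q (x - z)"
          using P[OF 2(2)] unfolding seminorm_on_def by blast
        then show ?thesis
          using that 2(1) by simp
      qed
      then show ?thesis
        using 2 Basis.prems by (intro exI[of _ "{q}"] exI[of _ "r - q (x - z)"]) auto
    qed
  qed auto
qed

text \<open>Continuity at 0 bounds \<open>e'\<close> on a basic neighbourhood, and a small multiple
  of \<open>D\<close> lies in it. This is what makes the restriction map end in
  \<open>F_G\<close>.\<close>

lemma bounded_wrt_imp_dual_bounded:
  fixes sE :: "'k::real_normed_field \<Rightarrow> 'e::ab_group_add \<Rightarrow> 'e" and p :: "'i \<Rightarrow> 'e \<Rightarrow> real"
  assumes E: "lcHs sE p" and e': "e' \<in> dual sE (seminorm_topology UNIV (range p))"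
    and D: "bounded_wrt p D"
  shows "bounded (e' ` D)"
proof -
  have vs: "vector_space sE" and sn: "\<And>i. seminorm_on sE UNIV (p i)"
    using E by (auto simp: lcHs_def)
  have lin: "e' (sE c x) = c * e' x" for c x
    using e' by (simp add: dual_def linear_on_def)
  have e'0: "e' 0 = 0"
    using lin[of 0 0] vs module.scale_zero_left[of sE] by (simp add: module_iff_vector_space)
  let ?W = "{x. e' x \<in> ball 0 1}"
  have "openin (seminorm_topology UNIV (range p)) ?W"
    using openin_continuous_map_preimage[of "seminorm_topology UNIV (range p)" euclidean e' "ball 0 1"] e'
    by (simp add: dual_def)
  moreover have "0 \<in> ?W"
    by (simp add: e'0)
  ultimately obtain Q r where Q: "finite Q" "Q \<subseteq> range p" "0 < r"
    "\<And>y. (\<forall>q\<in>Q. q y < r) \<Longrightarrow> norm (e' y) < 1"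
    using seminorm_topology_neighbourhood[of "range p" sE ?W 0] sn by auto
  have "\<forall>q\<in>Q. \<exists>C. \<forall>x\<in>D. q x \<le> C"
    using D Q(2) by (auto simp: bounded_wrt_def bdd_above_def)
  then obtain C where C: "\<And>q x. q \<in> Q \<Longrightarrow> x \<in> D \<Longrightarrow> q x \<le> C q"
    using bchoice[of Q "\<lambda>q C. \<forall>x\<in>D. q x \<le> C"] by blast
  \<comment> \<open>Inserting 1 keeps \<open>M\<close> positive even if all seminorm bounds are not,
    or if \<open>Q\<close> is empty.\<close>
  define M where "M = Max (insert 1 (C ` Q))"
  have M: "C q \<le> M" if "q \<in> Q" for q
    using Q(1) that by (auto simp: M_def)
  have M0: "0 < M"
    using Q(1) by (auto simp: M_def Max_gr_iff)
  have "norm (e' x) \<le> 2 * M / r" if x: "x \<in> D" for x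
  proof -
    define t where "t = r / (2 * M)"
    have t: "0 < t"
      using M0 Q(3) by (simp add: t_def)
    have "q (sE (of_real t) x) < r" if "q \<in> Q" for q
    proof -
      obtain i where "q = p i"
        using Q(2) \<open>q \<in> Q\<close> by auto
      then have "q (sE (of_real t) x) = t * q x"
        using sn[of i] t by (simp add: seminorm_on_def)
      also have "\<dots> \<le> t * M"
        using C[OF that x] M[OF that] t by (intro mult_left_mono) auto
      also have "\<dots> < r"
        using M0 Q(3) by (simp add: t_def)
      finally show ?thesis .
    qed
    then have "t * norm (e' x) < 1"
      using Q(4)[of "sE (of_real t) x"] t by (simp add: lin norm_mult)
    then show ?thesis
      using t M0 Q(3) by (simp add: t_def field_simps)
  qed
  then show ?thesis
    by (auto simp: bounded_iff)
qed

section \<open>Separation of points by \<open>G\<close> and weak limits in \<open>E\<close>\<close>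

text \<open>If all of \<open>G\<close> vanishes at \<open>x\<close>, then the multiples n x form a
  set bounded for \<open>G\<close>, hence bounded. This forces every seminorm of \<open>x\<close> to
  be 0, and the Hausdorff property finishes.\<close>

lemma determines_boundedness_separates:
  fixes sE :: "'k::real_normed_field \<Rightarrow> 'e::ab_group_add \<Rightarrow> 'e" and p :: "'i \<Rightarrow> 'e \<Rightarrow> real"
  assumes E: "lcHs sE p" and G: "G \<subseteq> dual sE (seminorm_topology UNIV (range p))"
    "determines_boundedness p G" and x: "\<And>e'. e' \<in> G \<Longrightarrow> e' x = 0"
  shows "x = 0"
proof (rule ccontr)
  assume "x \<noteq> 0"
  have sn: "\<And>i. seminorm_on sE UNIV (p i)"
    and H: "Hausdorff_space (seminorm_topology UNIV (range p))"
    using E by (auto simp: lcHs_def)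
  have "bounded (e' ` range (\<lambda>n::nat. sE (of_nat n) x))" if "e' \<in> G" for e'
  proof -
    have "e' (sE c x) = 0" for c
      using G(1) that x[OF that] by (auto simp: dual_def linear_on_def)
    then have "e' ` range (\<lambda>n::nat. sE (of_nat n) x) \<subseteq> {0}"
      by auto
    with bounded_subset[of "{0}"] show ?thesis
      by simp
  qed
  then have bdd: "bounded_wrt p (range (\<lambda>n::nat. sE (of_nat n) x))"
    using G(2) unfolding determines_boundedness_def by blast
  have p: "p i x = 0" for i
  proof -
    have "bdd_above (p i ` range (\<lambda>n::nat. sE (of_nat n) x))"
      using bdd by (simp add: bounded_wrt_def)
    then obtain C where "p i (sE (of_nat n) x) \<le> C" for n :: nat
      unfolding bdd_above_def by blast
    then have C: "real n * p i x \<le> C" for n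
      using sn[of i] by (simp add: seminorm_on_def)
    have "p i x \<le> 0"
    proof (rule ccontr)
      assume "\<not> p i x \<le> 0"
      then obtain n where "C < real n * p i x"
        using reals_Archimedean3[of "p i x"] by auto
      then show False
        using C[of n] by simp
    qed
    then show ?thesis
      using sn[of i] by (simp add: seminorm_on_def order_antisym)
  qed
  obtain A B where AB: "openin (seminorm_topology UNIV (range p)) A" "0 \<in> A" "x \<in> B" "disjnt A B"
    using H[unfolded Hausdorff_space_def, rule_format, of 0 x] \<open>x \<noteq> 0\<close> by auto
  obtain Q r where Q: "Q \<subseteq> range p" "0 < r" "\<And>y. (\<forall>q\<in>Q. q y < r) \<Longrightarrow> y \<in> A"
    using seminorm_topology_neighbourhood[of "range p" sE A 0] sn AB by auto
  have "q x < r" if "q \<in> Q" for q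
    using that Q(1,2) p by auto
  then have "x \<in> A"
    by (intro Q(3)) blast
  then show False
    using AB by (auto simp: disjnt_def)
qed

text \<open>The approximations lie in the Banach space spanned by the closed absolutely convex bounded
  set \<open>{e. \<forall>e' \<in> G. norm (e' e) \<le> c e'}\<close> and form a Cauchy sequence there.\<close>

lemma locally_complete_weak_limit:
  fixes sE :: "'k::real_normed_field \<Rightarrow> 'e::ab_group_add \<Rightarrow> 'e" and p :: "'i \<Rightarrow> 'e \<Rightarrow> real"
  assumes E: "lcHs sE p" "locally_complete sE p"
    and G: "G \<subseteq> dual sE (seminorm_topology UNIV (range p))" "determines_boundedness p G"
    and c: "\<And>e'. e' \<in> G \<Longrightarrow> 0 < c e'"
    and approx: "\<And>\<epsilon>. 0 < \<epsilon> \<Longrightarrow> \<exists>e. \<forall>e'\<in>G. norm (e' e - w e') \<le> \<epsilon> * c e'"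
  shows "\<exists>e. \<forall>e'\<in>G. e' e = w e'"
\<comment> \<open>The set \<open>D\<close> below is an intersection indexed by \<open>G\<close>,
  whose closedness is derived from a non-empty family. For empty \<open>G\<close> the claim is
  vacuous.\<close>
proof (cases "G = {}")
  case False
  have vs: "vector_space sE"
    using E by (auto simp: lcHs_def)
  then interpret vector_space sE .
  have add: "e' (x + y) = e' x + e' y" and scale: "e' (sE a x) = a * e' x" if "e' \<in> G" for e' a x y
    using G(1) that by (auto simp: dual_def linear_on_def)
  have diff: "e' (x - y) = e' x - e' y" if "e' \<in> G" for e' x y
    using add[OF that, of "x - y" y] by (simp add: algebra_simps)
  have zero: "e' 0 = 0" if "e' \<in> G" for e'
    using scale[OF that, of 0 0] by simp
  define D where "D = {e. \<forall>e'\<in>G. norm (e' e) \<le> c e'}"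
  have "closedin (seminorm_topology UNIV (range p)) {e. e' e \<in> cball 0 (c e')}" if "e' \<in> G" for e'
    using closedin_continuous_map_preimage[of "seminorm_topology UNIV (range p)" euclidean e' "cball 0 (c e')"]
      G(1) that by (auto simp: dual_def)
  moreover have "D = (\<Inter>e'\<in>G. {e. e' e \<in> cball 0 (c e')})"
    by (auto simp: D_def)
  ultimately have "closedin (seminorm_topology UNIV (range p)) D"
    using False by auto
  moreover have "bounded_wrt p D"
  proof -
    have "bounded (e' ` D)" if "e' \<in> G" for e'
      using that by (auto simp: D_def bounded_iff)
    then show ?thesis
      using G(2) unfolding determines_boundedness_def by blast
  qed
  moreover have "absolutely_convex sE D"
    unfolding absolutely_convex_def
  proof (intro conjI ballI allI impI)
    show "D \<noteq> {}"
      using c by (auto simp: D_def zero intro!: exI[of _ 0] less_imp_le)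
  next
    fix x y and a b :: 'k
    assume xy: "x \<in> D" "y \<in> D" and ab: "norm a + norm b \<le> 1"
    have "norm (e' (sE a x + sE b y)) \<le> c e'" if "e' \<in> G" for e'
    proof -
      have "norm (e' (sE a x + sE b y)) \<le> norm a * norm (e' x) + norm b * norm (e' y)"
        using norm_triangle_ineq[of "a * e' x" "b * e' y"] by (simp add: add scale that norm_mult)
      also have "\<dots> \<le> norm a * c e' + norm b * c e'"
        using xy that by (intro add_mono mult_left_mono) (auto simp: D_def)
      also have "\<dots> \<le> 1 * c e'"
        unfolding distrib_right[symmetric] using ab c[OF that] by (intro mult_right_mono) auto
      finally show ?thesis
        by simp
    qed
    then show "sE a x + sE b y \<in> D"
      by (simp add: D_def)
  qed
  ultimately have "banach_on sE (\<Union>n::nat. sE (of_nat n) ` D) (minkowski_gauge sE D)"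
    using E(2) unfolding locally_complete_def by blast
  moreover define V where "V = (\<Union>n::nat. sE (of_nat n) ` D)"
  ultimately have ban: "banach_on sE V (minkowski_gauge sE D)"
    by simp
  have subsp: "subspace V"
    using ban by (simp add: banach_on_def)
  have scaled: "x \<in> sE (of_real t) ` D" if "0 < t" "\<And>e'. e' \<in> G \<Longrightarrow> norm (e' x) \<le> t * c e'" for x t
  proof
    show "x = sE (of_real t) (sE (of_real (1 / t)) x)"
      using that by simp
    show "sE (of_real (1 / t)) x \<in> D"
      using that by (auto simp: D_def scale norm_mult norm_divide divide_le_eq mult.commute)
  qed
  \<comment> \<open>This and \<open>gauge_less\<close> translate between the gauge of
    \<open>D\<close> and the bounds on the functionals in \<open>G\<close>. The converse needs a
    strict inequality because the gauge is an infimum.\<close>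
  have gauge_le: "minkowski_gauge sE D x \<le> t"
    if "0 < t" "\<And>e'. e' \<in> G \<Longrightarrow> norm (e' x) \<le> t * c e'" for x t
    unfolding minkowski_gauge_def
    using that scaled[of t x] by (intro cInf_lower bdd_belowI[of _ 0]) auto
  have gauge_less: "norm (e' x) \<le> t * c e'" if "x \<in> V" "minkowski_gauge sE D x < t" "e' \<in> G" for x t e'
  proof -
    have "{t. 0 < t \<and> x \<in> sE (of_real t) ` D} \<noteq> {}"
    proof -
      from \<open>x \<in> V\<close> obtain n d where n: "x = sE (of_nat n) d" "d \<in> D"
        by (auto simp: V_def)
      \<comment> \<open>The factor n + 1 instead of n keeps the scaling positive when n is
        0.\<close>
      have "norm (e' x) \<le> (real n + 1) * c e'" if e': "e' \<in> G" for e'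
      proof -
        have "norm (e' x) = real n * norm (e' d)"
          using n e' by (simp add: scale norm_mult)
        also have "\<dots> \<le> (real n + 1) * c e'"
          using n e' c[OF e'] by (intro mult_mono) (auto simp: D_def)
        finally show ?thesis .
      qed
      then have "real n + 1 \<in> {t. 0 < t \<and> x \<in> sE (of_real t) ` D}"
        using scaled[of "real n + 1" x] by simp
      then show ?thesis
        by blast
    qed
    from cInf_lessD[OF this, of t] \<open>minkowski_gauge sE D x < t\<close>
    obtain t' where t': "0 < t'" "x \<in> sE (of_real t') ` D" "t' < t"
      by (auto simp: minkowski_gauge_def)
    then obtain d where d: "d \<in> D" "x = sE (of_real t') d"
      by blast
    have "norm (e' x) = t' * norm (e' d)"
      using d t' that by (simp add: scale norm_mult)
    also have "\<dots> \<le> t * c e'"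
      using d t' that c[OF that(3)] by (intro mult_mono) (auto simp: D_def)
    finally show ?thesis .
  qed
  have "\<forall>n. \<exists>e. \<forall>e'\<in>G. norm (e' e - w e') \<le> inverse (real (Suc n)) * c e'"
    by (intro allI approx) simp
  then obtain \<sigma> where \<sigma>: "\<And>n e'. e' \<in> G \<Longrightarrow> norm (e' (\<sigma> n) - w e') \<le> inverse (real (Suc n)) * c e'"
    by metis
  \<comment> \<open>\<open>w\<close> need not be bounded by a multiple of \<open>c\<close>, so the
    approximations themselves may lie outside \<open>V\<close>. Their differences do not, since the
    values of \<open>w\<close> cancel.\<close>
  define \<tau> where "\<tau> n = \<sigma> n - \<sigma> 0" for n
  have V: "x \<in> V" if "\<And>e'. e' \<in> G \<Longrightarrow> norm (e' x) \<le> 2 * c e'" for x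
    using scaled[of 2 x] that by (auto simp: V_def intro!: exI[of _ 2])
  have close: "norm (e' (\<tau> m - \<tau> n)) \<le> (inverse (real (Suc m)) + inverse (real (Suc n))) * c e'"
    if "e' \<in> G" for m n e'
  proof -
    have "norm (e' (\<tau> m - \<tau> n)) = norm ((e' (\<sigma> m) - w e') - (e' (\<sigma> n) - w e'))"
      by (simp add: \<tau>_def diff that)
    also have "\<dots> \<le> inverse (real (Suc m)) * c e' + inverse (real (Suc n)) * c e'"
      using \<sigma>[OF that, of m] \<sigma>[OF that, of n] norm_triangle_ineq4[of "e' (\<sigma> m) - w e'" "e' (\<sigma> n) - w e'"]
      by linarith
    finally show ?thesis
      by (simp add: algebra_simps)
  qed
  have \<tau>: "\<tau> n \<in> V" for n
  proof (rule V)
    fix e' assume "e' \<in> G"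
    have "norm (e' (\<tau> n - \<tau> 0)) \<le> (inverse (real (Suc n)) + inverse (real (Suc 0))) * c e'"
      using \<open>e' \<in> G\<close> by (rule close)
    also have "\<dots> \<le> 2 * c e'"
      using c[OF \<open>e' \<in> G\<close>] by (intro mult_right_mono) (auto simp: field_simps)
    finally show "norm (e' (\<tau> n)) \<le> 2 * c e'"
      by (simp add: \<tau>_def)
  qed
  have "\<exists>M. \<forall>m\<ge>M. \<forall>n\<ge>M. minkowski_gauge sE D (\<tau> m - \<tau> n) < \<epsilon>" if "0 < \<epsilon>" for \<epsilon>
  proof -
    obtain M where M: "inverse (real (Suc M)) < \<epsilon> / 2"
      using reals_Archimedean[of "\<epsilon> / 2"] \<open>0 < \<epsilon>\<close> by auto
    have "minkowski_gauge sE D (\<tau> m - \<tau> n) < \<epsilon>" if "M \<le> m" "M \<le> n" for m n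
    proof -
      have "inverse (real (Suc m)) \<le> inverse (real (Suc M))" "inverse (real (Suc n)) \<le> inverse (real (Suc M))"
        using that by auto
      then have "inverse (real (Suc m)) + inverse (real (Suc n)) < \<epsilon>"
        using M by linarith
      moreover have "minkowski_gauge sE D (\<tau> m - \<tau> n) \<le> inverse (real (Suc m)) + inverse (real (Suc n))"
        by (rule gauge_le[OF _ close]) (auto intro: add_pos_pos)
      ultimately show ?thesis
        by simp
    qed
    then show ?thesis
      by blast
  qed
  then obtain l where l: "l \<in> V" "(\<lambda>n. minkowski_gauge sE D (\<tau> n - l)) \<longlonglongrightarrow> 0"
    using ban \<tau> unfolding banach_on_def by blast
  \<comment> \<open>Adding \<open>\<sigma> 0\<close> undoes the shift. The sequence e' (\<sigma> n)
    tends to the left side by convergence in the gauge and to the right side by the choice of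
    \<open>\<sigma>\<close>.\<close>
  have "e' (l + \<sigma> 0) = w e'" if e': "e' \<in> G" for e'
  proof (rule LIMSEQ_unique)
    have "(\<lambda>n. e' (\<tau> n - l)) \<longlonglongrightarrow> 0"
    proof (rule LIMSEQ_I)
      fix r :: real assume "0 < r"
      then have "0 < r / (2 * c e')"
        using c[OF e'] by simp
      then obtain N where N: "\<And>n. N \<le> n \<Longrightarrow> norm (minkowski_gauge sE D (\<tau> n - l)) < r / (2 * c e')"
        using LIMSEQ_D[OF l(2)] by (metis diff_zero)
      have "norm (e' (\<tau> n - l)) < r" if "N \<le> n" for n
      proof -
        have "norm (e' (\<tau> n - l)) \<le> r / (2 * c e') * c e'"
          using N[OF that] subspace_diff[OF subsp \<tau> l(1)] by (intro gauge_less e') auto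
        also have "\<dots> < r"
          using c[OF e'] \<open>0 < r\<close> by simp
        finally show ?thesis .
      qed
      then show "\<exists>N. \<forall>n\<ge>N. norm (e' (\<tau> n - l) - 0) < r"
        by auto
    qed
    from tendsto_add[OF this tendsto_const[of "e' (l + \<sigma> 0)"]]
    show "(\<lambda>n. e' (\<sigma> n)) \<longlonglongrightarrow> e' (l + \<sigma> 0)"
      by (simp add: \<tau>_def diff add e')
    have "(\<lambda>n. inverse (real (Suc n)) * c e') \<longlonglongrightarrow> 0"
      using tendsto_mult_right[OF LIMSEQ_inverse_real_of_nat, of "c e'"] by simp
    then have "(\<lambda>n. e' (\<sigma> n) - w e') \<longlonglongrightarrow> 0"
      by (rule Lim_null_comparison[rotated]) (intro always_eventually allI \<sigma>[OF e'])
    then show "(\<lambda>n. e' (\<sigma> n)) \<longlonglongrightarrow> w e'"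
      by (simp add: LIM_zero_iff)
  qed
  then show ?thesis
    by blast
qed auto

section \<open>The dual, continuity for the kappa topology, and approximation on compact
  sets\<close>

lemma module_scalar_fun_scale: "module (scalar_fun_scale :: 'k::real_normed_field \<Rightarrow> ('a \<Rightarrow> 'k) \<Rightarrow> _)"
  by unfold_locales (simp_all add: fun_scale_def fun_eq_iff algebra_simps)

lemma dual_add: "\<phi> \<in> dual s T \<Longrightarrow> \<psi> \<in> dual s T \<Longrightarrow> \<phi> + \<psi> \<in> dual s T"
  by (auto simp: dual_def linear_on_def plus_fun_def algebra_simps intro: continuous_map_add)

lemma dual_scale:
  assumes "\<phi> \<in> dual s T"
  shows "scalar_fun_scale c \<phi> \<in> dual s T"
proof -
  have "continuous_map euclidean euclidean ((*) c)"
    by (auto intro: continuous_intros)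
  then have "continuous_map T euclidean ((*) c \<circ> \<phi>)"
    using assms by (intro continuous_map_compose[where X' = euclidean]) (auto simp: dual_def)
  then show ?thesis
    using assms by (auto simp: dual_def linear_on_def fun_scale_def o_def algebra_simps)
qed

lemma dual_diff:
  assumes "\<phi> \<in> dual s T" "\<psi> \<in> dual s T"
  shows "\<phi> - \<psi> \<in> dual s T"
proof -
  have "\<phi> - \<psi> = \<phi> + scalar_fun_scale (- 1) \<psi>"
    by (simp add: fun_eq_iff fun_scale_def)
  then show ?thesis
    using dual_add[OF assms(1) dual_scale[OF assms(2)]] by metis
qed

text \<open>\<open>B\<close> is itself one of the sets defining the kappa topology, so the supremum
  over \<open>B\<close> is one of its seminorms. Boundedness on the polar means that this single
  seminorm controls \<open>u\<close>.\<close>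

lemma kappa_continuous_if_bounded_on_polar:
  fixes s :: "'k::real_normed_field \<Rightarrow> 'v::ab_group_add \<Rightarrow> 'v" and p :: "'i \<Rightarrow> 'e::ab_group_add \<Rightarrow> real"
  assumes sn: "\<And>i. seminorm_on sE UNIV (p i)"
    and B: "absolutely_convex s B" "compactin T B"
    and u: "linear_on scalar_fun_scale sE (dual s T) u" "bounded_wrt p (u ` polar s T B)"
  shows "continuous_map (kappa_topology s T) (seminorm_topology UNIV (range p)) u"
  unfolding seminorm_topology_def
proof (rule continuous_on_generated_topo)
  define N where "N \<phi> = (SUP x\<in>B. norm (\<phi> x))" for \<phi> :: "'v \<Rightarrow> 'k"
  \<comment> \<open>Compactness of \<open>B\<close> makes the set of values bounded, without which
    \<open>SUP\<close> need not be an upper bound.\<close>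
  have N: "norm (\<phi> x) \<le> N \<phi>" if "\<phi> \<in> dual s T" "x \<in> B" for \<phi> x
  proof -
    have "compactin euclidean (\<phi> ` B)"
      using B(2) by (rule image_compactin) (use that in \<open>simp add: dual_def\<close>)
    then have "bounded (\<phi> ` B)"
      by (simp add: compact_imp_bounded)
    then have "bdd_above ((\<lambda>x. norm (\<phi> x)) ` B)"
      by (auto simp: bounded_iff bdd_above_def)
    then show ?thesis
      using that(2) unfolding N_def by (rule cSUP_upper[rotated])
  qed
  have u_diff: "u (\<phi> - \<psi>) = u \<phi> - u \<psi>" if "\<phi> \<in> dual s T" "\<psi> \<in> dual s T" for \<phi> \<psi>
  proof -
    have "u ((\<phi> - \<psi>) + \<psi>) = u (\<phi> - \<psi>) + u \<psi>"
      using u(1) that dual_diff[OF that] unfolding linear_on_def by blast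
    then show ?thesis
      by (simp add: eq_diff_eq)
  qed
  fix W assume "W \<in> insert UNIV {{y \<in> UNIV. q (y - x) < r} |q x r. q \<in> range p \<and> x \<in> UNIV \<and> 0 < r}"
  then consider "W = UNIV" | i z r where "W = {y. p i (y - z) < r}" "0 < r"
    by auto
  then show "openin (kappa_topology s T) (u -` W \<inter> topspace (kappa_topology s T))"
  proof cases
    case 1
    then show ?thesis
      by simp
  next
    case (2 i z r)
    have "\<exists>C0. \<forall>\<phi>\<in>polar s T B. p i (u \<phi>) \<le> C0"
      using u(2) by (auto simp: bounded_wrt_def bdd_above_def)
    then obtain C0 where C0: "\<And>\<phi>. \<phi> \<in> polar s T B \<Longrightarrow> p i (u \<phi>) \<le> C0"
      by blast
    define C where "C = max 1 C0"
    have C: "p i (u \<phi>) \<le> C" if "\<phi> \<in> polar s T B" for \<phi>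
      using C0[OF that] by (auto simp: C_def)
    have "0 < C"
      by (simp add: C_def)
    \<comment> \<open>Dividing by some \<delta> above \<open>N \<phi>\<close>, rather than by
      \<open>N \<phi>\<close>, allows for the value 0.\<close>
    have bound: "p i (u \<phi>) \<le> \<delta> * C" if "\<phi> \<in> dual s T" "N \<phi> < \<delta>" "0 < \<delta>" for \<phi> \<delta>
    proof -
      have "norm (\<phi> x) \<le> \<delta>" if "x \<in> B" for x
        using N[OF \<open>\<phi> \<in> dual s T\<close> that] \<open>N \<phi> < \<delta>\<close> by simp
      then have "scalar_fun_scale (of_real (1 / \<delta>)) \<phi> \<in> polar s T B"
        unfolding polar_def mem_Collect_eq using \<open>0 < \<delta>\<close>
        by (intro conjI dual_scale[OF \<open>\<phi> \<in> dual s T\<close>])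
          (simp add: fun_scale_def norm_mult norm_divide divide_le_eq)
      then have "p i (u (scalar_fun_scale (of_real (1 / \<delta>)) \<phi>)) \<le> C"
        by (rule C)
      also have "u (scalar_fun_scale (of_real (1 / \<delta>)) \<phi>) = sE (of_real (1 / \<delta>)) (u \<phi>)"
        using u(1) that(1) by (simp add: linear_on_def)
      also have "p i \<dots> = 1 / \<delta> * p i (u \<phi>)"
        using sn[of i] that(3) by (simp add: seminorm_on_def norm_divide)
      finally show ?thesis
        using that(3) by (simp add: field_simps)
    qed
    show ?thesis
    proof (subst openin_subopen, intro ballI)
      fix \<phi> assume "\<phi> \<in> u -` W \<inter> topspace (kappa_topology s T)"
      then have \<phi>: "\<phi> \<in> dual s T" "p i (u \<phi> - z) < r"
        by (auto simp: kappa_topology_def 2)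
      \<comment> \<open>Chosen so that \<delta> C is half of the room left between p i (u \<phi> -
        z) and r.\<close>
      define \<delta> where "\<delta> = (r - p i (u \<phi> - z)) / (2 * C)"
      have \<delta>: "0 < \<delta>"
        using \<phi> \<open>0 < C\<close> by (simp add: \<delta>_def)
      let ?O = "{\<psi> \<in> dual s T. N (\<psi> - \<phi>) < \<delta>}"
      have "openin (kappa_topology s T) ?O"
        unfolding kappa_topology_def
        by (rule openin_seminorm_ball) (use B \<phi> \<delta> in \<open>auto simp: N_def[abs_def]\<close>)
      moreover have "\<phi> \<in> ?O"
      proof -
        have "B \<noteq> {}"
          using B by (simp add: absolutely_convex_def)
        then show ?thesis
          using \<phi> \<delta> by (simp add: N_def)
      qed
      moreover have "\<psi> \<in> u -` W \<inter> topspace (kappa_topology s T)" if "\<psi> \<in> ?O" for \<psi>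
      proof -
        have "p i ((u \<psi> - u \<phi>) + (u \<phi> - z)) \<le> p i (u \<psi> - u \<phi>) + p i (u \<phi> - z)"
          using sn[of i] unfolding seminorm_on_def by blast
        then have "p i (u \<psi> - z) \<le> p i (u (\<psi> - \<phi>)) + p i (u \<phi> - z)"
          using that \<phi> by (simp add: u_diff)
        also have "\<dots> \<le> \<delta> * C + p i (u \<phi> - z)"
          using bound[of "\<psi> - \<phi>" \<delta>] that \<phi> \<delta> by (simp add: dual_diff)
        also have "\<dots> < r"
          using \<open>0 < C\<close> \<phi> by (simp add: \<delta>_def field_simps)
        finally show ?thesis
          using that by (simp add: 2 kappa_topology_def)
      qed
      ultimately show "\<exists>O'. openin (kappa_topology s T) O' \<and> \<phi> \<in> O' \<and> O' \<subseteq> u -` W \<inter> topspace (kappa_topology s T)"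
        by blast
    qed
  qed
qed auto

text \<open>By the finite intersection property, \<open>\<bar>y\<bar> < \<epsilon>\<close> already holds on the common kernel in \<open>B\<close>
  of finitely many \<open>g x\<close>; a finite Hahn--Banach argument then yields the approximation.\<close>

lemma compact_functional_approx:
  fixes s :: "'k::real_or_complex \<Rightarrow> 'v::ab_group_add \<Rightarrow> 'v" and g :: "'o \<Rightarrow> 'v \<Rightarrow> 'k"
  assumes V: "module s" "module.subspace s (topspace T)"
    and B: "absolutely_convex s B" "compactin T B"
    and g: "\<And>x. x \<in> U \<Longrightarrow> g x \<in> dual s T"
    and unique: "\<And>f. f \<in> B \<Longrightarrow> \<forall>x\<in>U. g x f = 0 \<Longrightarrow> f = 0"
    and y: "y \<in> dual s T" and "0 < \<epsilon>"
  shows "\<exists>A a. finite A \<and> A \<subseteq> U \<and> (\<forall>f\<in>B. norm (y f - (\<Sum>x\<in>A. a x * g x f)) \<le> \<epsilon>)"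
proof -
  interpret module s by (rule V)
  have BT: "B \<subseteq> topspace T"
    using B compactin_subset_topspace by blast
  have lin: "\<phi> (s a f + s b f') = a * \<phi> f + b * \<phi> f'"
    if "\<phi> \<in> dual s T" "f \<in> B" "f' \<in> B" for \<phi> a b f f'
    using that BT subspace_scale[OF V(2)] by (auto simp: dual_def linear_on_def subset_iff)
  have "y (s 0 0) = 0 * y 0"
    using y subspace_0[OF V(2)] by (auto simp only: dual_def linear_on_def mem_Collect_eq)
  then have y0: "y 0 = 0"
    by simp
  \<comment> \<open>Closed sets for the finite intersection property: the kernels of the
    \<open>g x\<close>, and the set where the norm of \<open>y\<close> is at least \<epsilon>. In
    \<open>B\<close> the kernels meet at most in 0, where \<open>y\<close> vanishes.\<close>
  define Z where "Z x = {f \<in> topspace T. g x f \<in> {0}}" for x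
  define Y where "Y = {f \<in> topspace T. y f \<in> - ball 0 \<epsilon>}"
  have Z: "closedin T (Z x)" if "x \<in> U" for x
    unfolding Z_def using g[OF that]
    by (intro closedin_continuous_map_preimage[where Y = euclidean]) (auto simp: dual_def)
  have Y: "closedin T Y"
    unfolding Y_def using y
    by (intro closedin_continuous_map_preimage[where Y = euclidean]) (auto simp: dual_def)
  have "B \<inter> \<Inter>(insert Y (Z ` U)) = {}"
  proof -
    have False if f: "f \<in> B" "f \<in> Y" "\<And>x. x \<in> U \<Longrightarrow> f \<in> Z x" for f
    proof -
      have "f = 0"
        using f by (intro unique) (auto simp: Z_def)
      then show False
        using f(2) y0 \<open>0 < \<epsilon>\<close> by (simp add: Y_def)
    qed
    then show ?thesis
      by blast
  qed
  moreover have "\<forall>C\<in>insert Y (Z ` U). closedin T C"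
    using Y Z by blast
  ultimately obtain \<F> where \<F>: "finite \<F>" "\<F> \<subseteq> insert Y (Z ` U)" "B \<inter> \<Inter>\<F> = {}"
    using conjunct2[OF iffD1[OF compactin_fip B(2)], rule_format, of "insert Y (Z ` U)"] by auto
  \<comment> \<open>The finite subfamily may or may not contain \<open>Y\<close>. In both cases a
    point of \<open>B\<close> lying in all the remaining kernels is outside
    \<open>Y\<close>.\<close>
  then have "finite (\<F> - {Y})" "\<F> - {Y} \<subseteq> Z ` U"
    by auto
  then obtain A where A: "A \<subseteq> U" "finite A" "\<F> - {Y} = Z ` A"
    using finite_subset_image[of "\<F> - {Y}" Z U] by auto
  have "\<exists>a. \<forall>f\<in>B. norm (y f - (\<Sum>x\<in>A. a x * g x f)) \<le> \<epsilon>"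
  proof (rule functional_minus_combination_le[OF A(2) B(1)])
    fix f assume f: "f \<in> B" "\<forall>x\<in>A. g x f = 0"
    have "f \<in> C" if "C \<in> \<F>" "C \<noteq> Y" for C
    proof -
      have "C \<in> Z ` A"
        using that A(3) by blast
      then show ?thesis
        using f BT by (auto simp: Z_def)
    qed
    then have "f \<notin> Y"
      using \<F>(3) f(1) by blast
    then show "norm (y f) \<le> \<epsilon>"
      using f(1) BT by (auto simp: Y_def)
  qed (use lin g A(1) y in auto)
  then show ?thesis
    using A by blast
qed

section \<open>Surjectivity of the restriction map\<close>

theorem theorem5p2p29:
  fixes sE :: "'k::real_or_complex \<Rightarrow> 'e::ab_group_add \<Rightarrow> 'e"
    and p :: "'i \<Rightarrow> 'e \<Rightarrow> real"
    and G :: "('e \<Rightarrow> 'k) set"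
    and \<nu> :: "'o \<Rightarrow> real"
    and domK APK :: "('x \<Rightarrow> 'k) set" and TK :: "('x \<Rightarrow> 'k) \<Rightarrow> 'o \<Rightarrow> 'k"
    and domE APE :: "('x \<Rightarrow> 'e) set" and TE :: "('x \<Rightarrow> 'e) \<Rightarrow> 'o \<Rightarrow> 'e"
    and FK :: "('x \<Rightarrow> 'k) set" and FT :: "('x \<Rightarrow> 'k) topology"
    and FE :: "('x \<Rightarrow> 'e) set" and FET :: "('x \<Rightarrow> 'e) topology"
    and U :: "'o set"
  assumes E: "lcHs sE p"
    and weight: "\<And>x. \<nu> x > 0"
    and dom_K: "module.subspace scalar_fun_scale domK"
    and lin_K: "linear_on scalar_fun_scale scalar_fun_scale domK TK"
    and AP_K: "module.subspace scalar_fun_scale APK"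
    and dom_E: "module.subspace (fun_scale sE) domE"
    and lin_E: "linear_on (fun_scale sE) (fun_scale sE) domE TE"
    and AP_E: "module.subspace (fun_scale sE) APE"
    and FK: "FK = APK \<inter> domK" "topspace FT = FK" "locally_convex_Hausdorff scalar_fun_scale FT"
    and FE: "FE = APE \<inter> domE" "topspace FET = FE" "locally_convex_Hausdorff (fun_scale sE) FET"
    and delta: "\<And>x. point_eval FK x \<in> dual scalar_fun_scale FT"
    and "locally_complete sE p"
    and G: "module.subspace scalar_fun_scale G"
      "G \<subseteq> dual sE (seminorm_topology UNIV (range p))"
      "determines_boundedness p G"
    and "eps_into_compatible sE p FT FET"
    and "generator p \<nu> FK TK FE TE"
    and "strong sE p FK TK FE TE"
    and "consistent sE p FT TK FET TE"
    and "banach_on scalar_fun_scale (weighted_space FK TK \<nu> norm_system)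
           (weighted_seminorm TK \<nu> norm_system ())"
    and "compactin FT (unit_ball FK TK \<nu>)"
    and "set_of_uniqueness FK TK \<nu> U"
  shows "restriction_map TE U ` F_eps sE p \<nu> FT TK = F_G FK TK \<nu> G U"
proof -
  note loc = \<open>locally_complete sE p\<close> and strong = \<open>strong sE p FK TK FE TE\<close>
    and consistent = \<open>consistent sE p FT TK FET TE\<close>
    and compact = \<open>compactin FT (unit_ball FK TK \<nu>)\<close>
  define Z where "Z = weighted_space FK TK \<nu> norm_system"
  define N where "N = weighted_seminorm TK \<nu> norm_system ()"
  define B where "B = unit_ball FK TK \<nu>"
  define \<tau> where "\<tau> x = point_eval_T FK TK x" for x
  have sn: "\<And>i. seminorm_on sE UNIV (p i)"
    using E by (auto simp: lcHs_def)
  interpret E: vector_space sE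
    using E by (simp add: lcHs_def)
  interpret M: module "scalar_fun_scale :: 'k \<Rightarrow> ('x \<Rightarrow> 'k) \<Rightarrow> 'x \<Rightarrow> 'k"
    by (rule module_scalar_fun_scale)
  have subZ: "M.subspace Z" and snN: "seminorm_on scalar_fun_scale Z N"
    using \<open>banach_on _ _ _\<close> by (auto simp: banach_on_def Z_def N_def)
  have subF: "M.subspace FK"
    unfolding FK(1) using AP_K dom_K by (rule M.subspace_inter)
  have ZF: "Z \<subseteq> FK"
    by (auto simp: Z_def weighted_space_def)
  have B: "B = {f \<in> Z. N f \<le> 1}"
    by (auto simp: B_def unit_ball_def Z_def N_def)
  have N_upper: "norm (TK f x) * \<nu> x \<le> N f" if "f \<in> Z" for f x
    using that unfolding Z_def N_def weighted_space_def weighted_seminorm_def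
    by (auto intro: cSUP_upper)
  have "absolutely_convex scalar_fun_scale B"
    unfolding absolutely_convex_def
  proof (intro conjI ballI allI impI)
    have "N (scalar_fun_scale 0 0) = 0"
      using snN M.subspace_0[OF subZ] unfolding seminorm_on_def by (metis mult_zero_left norm_zero)
    then show "B \<noteq> {}"
      using M.subspace_0[OF subZ] by (auto simp: B intro!: exI[of _ 0])
  next
    fix f f' and a b :: 'k
    assume f: "f \<in> B" "f' \<in> B" and ab: "norm a + norm b \<le> 1"
    then have Z: "scalar_fun_scale a f \<in> Z" "scalar_fun_scale b f' \<in> Z"
      by (auto simp: B M.subspace_scale[OF subZ])
    then have "N (scalar_fun_scale a f + scalar_fun_scale b f') \<le> norm a * N f + norm b * N f'"
      using snN f unfolding seminorm_on_def B by (smt (verit) mem_Collect_eq)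
    also have "\<dots> \<le> norm a * 1 + norm b * 1"
      using f by (intro add_mono mult_left_mono) (auto simp: B)
    finally show "scalar_fun_scale a f + scalar_fun_scale b f' \<in> B"
      using ab Z M.subspace_add[OF subZ] by (simp add: B)
  qed
  note absconv = this
  have compactB: "compactin FT B"
    using compact by (simp add: B_def)
  \<comment> \<open>Consistency asserts that \<open>\<tau> x\<close> is in the dual only under a
    quantifier over the \<epsilon>-product; the zero map instantiates it.\<close>
  have "(\<lambda>_. 0) \<in> eps_product scalar_fun_scale FT sE p"
    by (simp add: eps_product_def linear_on_def)
  then have \<tau>: "\<tau> x \<in> dual scalar_fun_scale FT" for x
    using consistent unfolding consistent_def \<tau>_def FK(2) by blast
  have \<tau>_eq: "\<tau> x f = TK f x" if "f \<in> FK" for x f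
    using that by (simp add: \<tau>_def point_eval_T_def restrict0_def)
  have TE: "TE (S_map FT u) x = u (\<tau> x)" "S_map FT u \<in> FE"
    if "u \<in> eps_product scalar_fun_scale FT sE p" for u x
    using consistent that unfolding consistent_def \<tau>_def FK(2) FE(2) by auto
  have e'_add: "e' (x + y) = e' x + e' y" and e'_scale: "e' (sE a x) = a * e' x"
    if "e' \<in> G" for e' a x y
    using G(2) that by (auto simp: dual_def linear_on_def)
  \<comment> \<open>The restriction map is well defined: for e' in \<open>G\<close> the function
    required by \<open>F_G\<close> is the composition of e' with \<open>f\<close>.\<close>
  have "restriction_map TE U f \<in> F_G FK TK \<nu> G U" if f: "f \<in> F_eps sE p \<nu> FT TK" for f
  proof -
    from f obtain u where u: "u \<in> eps_product scalar_fun_scale FT sE p" "f = S_map FT u"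
      "bounded_wrt p (u ` polar scalar_fun_scale FT B)"
      by (auto simp: F_eps_def B_def FK(2))
    have "\<exists>g\<in>Z. \<forall>x\<in>U. TK g x = (e' \<circ> restriction_map TE U f) x" if e': "e' \<in> G" for e'
    proof (intro bexI ballI)
      have *: "e' \<circ> f \<in> FK" "TK (e' \<circ> f) x = e' (u (\<tau> x))" for x
        using strong e' G(2) TE[OF u(1)] u(2) unfolding strong_def by auto
      have "bounded (e' ` u ` polar scalar_fun_scale FT B)"
        using bounded_wrt_imp_dual_bounded[OF E _ u(3)] e' G(2) by blast
      then obtain C where C: "\<And>y. y \<in> polar scalar_fun_scale FT B \<Longrightarrow> norm (e' (u y)) \<le> C"
        by (auto simp: bounded_iff)
      have "norm (TK (e' \<circ> f) x) * \<nu> x \<le> C" for x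
      proof -
        \<comment> \<open>The weighted functional \<nu>(x) \<open>\<tau> x\<close> lies in the polar
          of \<open>B\<close>, so the bound of \<open>u\<close> there bounds the weighted seminorm
          uniformly in x.\<close>
        have "norm (scalar_fun_scale (of_real (\<nu> x)) (\<tau> x) g) \<le> 1" if "g \<in> B" for g
          using that N_upper[of g x] weight[of x] \<tau>_eq[of g x] ZF
          by (auto simp: B fun_scale_def norm_mult mult.commute)
        then have "scalar_fun_scale (of_real (\<nu> x)) (\<tau> x) \<in> polar scalar_fun_scale FT B"
          using dual_scale[OF \<tau>] by (auto simp: polar_def)
        then have "norm (e' (u (scalar_fun_scale (of_real (\<nu> x)) (\<tau> x)))) \<le> C"
          by (rule C)
        also have "u (scalar_fun_scale (of_real (\<nu> x)) (\<tau> x)) = sE (of_real (\<nu> x)) (u (\<tau> x))"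
          using u(1) \<tau> by (simp add: eps_product_def linear_on_def)
        finally show ?thesis
          using e' weight[of x] by (simp add: * e'_scale norm_mult mult.commute)
      qed
      then show "e' \<circ> f \<in> Z"
        using *(1) by (auto simp: Z_def weighted_space_def bdd_above_def)
      show "TK (e' \<circ> f) x = (e' \<circ> restriction_map TE U f) x" if "x \<in> U" for x
        using that *(2)[of x] TE[OF u(1)] u(2) by (simp add: restriction_map_def)
    qed
    then show ?thesis
      by (auto simp: F_G_def Z_def restriction_map_def)
  qed
  moreover have "h \<in> restriction_map TE U ` F_eps sE p \<nu> FT TK" if h: "h \<in> F_G FK TK \<nu> G U" for h
  proof -
    have "\<forall>e'\<in>G. \<exists>g\<in>Z. \<forall>x\<in>U. TK g x = e' (h x)"
      using h by (auto simp: F_G_def Z_def)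
    then obtain g where g: "\<And>e'. e' \<in> G \<Longrightarrow> g e' \<in> Z"
      "\<And>e' x. e' \<in> G \<Longrightarrow> x \<in> U \<Longrightarrow> TK (g e') x = e' (h x)"
      by metis
    \<comment> \<open>Adding 1 keeps \<open>c e'\<close> positive when \<open>g e'\<close> is 0.
      Dividing by it moves \<open>g e'\<close> into \<open>B\<close>, where the approximation of
      functionals is available.\<close>
    define c where "c e' = N (g e') + 1" for e'
    have c: "0 < c e'" if "e' \<in> G" for e'
      using snN g(1)[OF that] unfolding seminorm_on_def c_def by fastforce
    define b where "b e' = scalar_fun_scale (of_real (1 / c e')) (g e')" for e'
    have b: "b e' \<in> B" if "e' \<in> G" for e'
    proof -
      have "N (b e') = 1 / c e' * N (g e')"
        using snN g(1)[OF that] c[OF that] unfolding seminorm_on_def b_def by (simp add: norm_divide)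
      then have "N (b e') \<le> 1"
        using c[OF that] by (simp add: divide_le_eq) (simp add: c_def)
      then show ?thesis
        using M.subspace_scale[OF subZ g(1)[OF that]] by (simp add: B b_def)
    qed
    have g_eq: "y (g e') = of_real (c e') * y (b e')"
      if "e' \<in> G" "y \<in> dual scalar_fun_scale FT" for y e'
    proof -
      have "y (b e') = of_real (1 / c e') * y (g e')"
        using that g(1) ZF unfolding b_def dual_def linear_on_def FK(2) by blast
      then show ?thesis
        using c[OF that(1)] by simp
    qed
    have "\<exists>e. \<forall>e'\<in>G. e' e = y (g e')" if y: "y \<in> dual scalar_fun_scale FT" for y
    proof (rule locally_complete_weak_limit[OF E loc G(2,3) c])
      fix \<epsilon> :: real
      assume "0 < \<epsilon>"
      have "\<exists>A a. finite A \<and> A \<subseteq> U \<and> (\<forall>f\<in>B. norm (y f - (\<Sum>x\<in>A. a x * \<tau> x f)) \<le> \<epsilon>)"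
      proof (rule compact_functional_approx[OF module_scalar_fun_scale _ absconv compactB \<tau> _ y \<open>0 < \<epsilon>\<close>])
        show "M.subspace (topspace FT)"
          using subF by (simp add: FK(2))
        show "f = 0" if "f \<in> B" "\<forall>x\<in>U. \<tau> x f = 0" for f
          using \<open>set_of_uniqueness FK TK \<nu> U\<close> that \<tau>_eq[of f] ZF
          by (auto simp: set_of_uniqueness_def B Z_def)
      qed
      then obtain A a where A: "finite A" "A \<subseteq> U"
        "\<And>f. f \<in> B \<Longrightarrow> norm (y f - (\<Sum>x\<in>A. a x * \<tau> x f)) \<le> \<epsilon>"
        by blast
      \<comment> \<open>The coefficients of the approximation of \<open>y\<close> are applied to the
        values of \<open>h\<close>; since e' (h x) = \<open>\<tau> x (g e')\<close> on
        \<open>U\<close>, the functional e' sends this sum to the approximation evaluated at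
        \<open>g e'\<close>.\<close>
      define e where "e = (\<Sum>x\<in>A. sE (a x) (h x))"
      have "norm (e' e - y (g e')) \<le> \<epsilon> * c e'" if e': "e' \<in> G" for e'
      proof -
        have "e' 0 = 0"
          using e'_scale[OF e', of 0 0] by simp
        have "e' (\<Sum>x\<in>A'. sE (a x) (h x)) = (\<Sum>x\<in>A'. a x * e' (h x))" if "finite A'" for A'
          using that by induction (auto simp: \<open>e' 0 = 0\<close> e'_add e'_scale e')
        then have "e' e = (\<Sum>x\<in>A. a x * e' (h x))"
          using A(1) by (simp add: e_def)
        also have "\<dots> = (\<Sum>x\<in>A. a x * \<tau> x (g e'))"
          using A(2) ZF g e' \<tau>_eq by (intro sum.cong) (auto simp: subset_iff)
        also have "\<dots> = of_real (c e') * (\<Sum>x\<in>A. a x * \<tau> x (b e'))"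
          unfolding sum_distrib_left using g_eq[OF e' \<tau>] by (intro sum.cong) auto
        finally have "e' e - y (g e') = - of_real (c e') * (y (b e') - (\<Sum>x\<in>A. a x * \<tau> x (b e')))"
          by (simp add: g_eq[OF e' y] algebra_simps)
        then have "norm (e' e - y (g e')) = c e' * norm (y (b e') - (\<Sum>x\<in>A. a x * \<tau> x (b e')))"
          using c[OF e'] by (simp add: norm_mult)
        then show ?thesis
          using A(3)[OF b[OF e']] c[OF e'] by (simp add: mult.commute)
      qed
      then show "\<exists>e. \<forall>e'\<in>G. norm (e' e - y (g e')) \<le> \<epsilon> * c e'"
        by blast
    qed
    then obtain v where v: "\<And>y e'. y \<in> dual scalar_fun_scale FT \<Longrightarrow> e' \<in> G \<Longrightarrow> e' (v y) = y (g e')"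
      by metis
    \<comment> \<open>Elements of \<open>eps_product\<close> vanish off the dual, whereas the chosen
      \<open>v\<close> is arbitrary there.\<close>
    define u where "u y = (if y \<in> dual scalar_fun_scale FT then v y else 0)" for y
    have eqI: "e = e2" if "\<And>e'. e' \<in> G \<Longrightarrow> e' e = e' e2" for e e2
    proof -
      have "e' (e - e2) = 0" if "e' \<in> G" for e'
        using e'_add[OF that, of "e - e2" e2] \<open>\<And>e'. e' \<in> G \<Longrightarrow> e' e = e' e2\<close>[OF that] by simp
      then show ?thesis
        using determines_boundedness_separates[OF E G(2,3), of "e - e2"] by simp
    qed
    have lin: "linear_on scalar_fun_scale sE (dual scalar_fun_scale FT) u"
      unfolding linear_on_def
    proof (intro conjI ballI allI)
      fix y y' assume "y \<in> dual scalar_fun_scale FT" "y' \<in> dual scalar_fun_scale FT"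
      then show "u (y + y') = u y + u y'"
        by (intro eqI) (simp add: u_def v dual_add e'_add)
    next
      fix a y assume "y \<in> dual scalar_fun_scale FT"
      then show "u (scalar_fun_scale a y) = sE a (u y)"
        by (intro eqI) (simp add: u_def v dual_scale[unfolded fun_scale_def] e'_scale fun_scale_def)
    qed
    have "bounded (e' ` u ` polar scalar_fun_scale FT B)" if "e' \<in> G" for e'
    proof -
      \<comment> \<open>e' (u y) equals c e' times y (b e'), and \<open>b e'\<close> is in
        \<open>B\<close>.\<close>
      have "norm (e' (u y)) \<le> c e'" if y: "y \<in> polar scalar_fun_scale FT B" for y
      proof -
        have "y \<in> dual scalar_fun_scale FT" "norm (y (b e')) \<le> 1"
          using y b[OF \<open>e' \<in> G\<close>] by (auto simp: polar_def)
        then show ?thesis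
          using \<open>e' \<in> G\<close> c[OF \<open>e' \<in> G\<close>] by (simp add: u_def v g_eq norm_mult)
      qed
      then show ?thesis
        by (auto simp: bounded_iff)
    qed
    then have bdd: "bounded_wrt p (u ` polar scalar_fun_scale FT B)"
      using G(3) unfolding determines_boundedness_def by blast
    have "u \<in> eps_product scalar_fun_scale FT sE p"
      using lin kappa_continuous_if_bounded_on_polar[where s = scalar_fun_scale, OF sn absconv compactB lin bdd]
      by (simp add: eps_product_def u_def)
    \<comment> \<open>Every e' in \<open>G\<close> sends both sides to \<open>TK (g e') x\<close>.
      Consistency then identifies u (\<tau> x) with \<open>TE (S_map FT u) x\<close>.\<close>
    moreover have "u (\<tau> x) = h x" if "x \<in> U" for x
      by (rule eqI) (use that \<tau> g ZF in \<open>auto simp: u_def v \<tau>_eq subset_iff\<close>)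
    moreover have "h \<in> extensional U"
      using h by (simp add: F_G_def)
    ultimately have "restriction_map TE U (S_map FT u) = h"
      using TE by (auto simp: restriction_map_def fun_eq_iff extensional_def)
    moreover have "S_map FT u \<in> F_eps sE p \<nu> FT TK"
      using \<open>u \<in> eps_product _ _ _ _\<close> bdd by (auto simp: F_eps_def B_def FK(2))
    ultimately show ?thesis
      by blast
  qed
  ultimately show ?thesis
    by blast
qed

end
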